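(* Let the Schröder slicings grow as follows. The root is the single cell. The children of a Schröder slicing $P$ are the Schröder slicings obtained from $P$ in one of two ways: - by adding a new horizontal block as a new topmost row, right-aligned with the right side of the bounding rectangle of $P$; - by adding a new vertical block as a new rightmost column, top-aligned with the top of the bounding rectangle of $P$ (of any height from $1$ to the height of the rightmost column of $P$). Label each Schröder slicing by $(h,k)$, where $h$ is the maximal width of a horizontal block that can be added while remaining a Schröder slicing and $k$ is the height of its rightmost column. Then the root has label $(1,1)$, and a slicing with label $(h,k)$ has children with labels exactly $$(1,k+1),\ldots,(h,k+1),\ (2,1),\ldots,(2,k-1),\ (h+1,k).$$ Hence the generating tree of Schröder slicings is the tree $\mathcal{T}_{\mathrm{Sch}}$ of this succession rule (NewSch), and Schröder slicings are counted by the large Schröder numbers.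
   Context: A parallelogram polyomino is an edge-connected set of unit cells of the plane forming the interior of a contour made of two lattice paths with unit steps $(0,1)$ and $(1,0)$. The two paths meet only at their common start and at their common end. The size is $k+\ell-1$ for a $k\times\ell$ bounding rectangle. A Baxter slicing of size $n$ is a parallelogram polyomino $P$ of size $n$ whose interior is divided into $n$ blocks, defined recursively: - for $n=1$, the single cell is the single block; - for $n\ge2$, one block is either the topmost row of $P$ (a horizontal block) or the rightmost column of $P$ (a vertical block), and the remaining $n-1$ blocks form a Baxter slicing of the polyomino obtained by deleting that row, respectively that column. For a horizontal block $u$ of a Baxter slicing of $P$: - $\ell(u)$ is the width of $u$; - $X(u)$ is the lowest point of the lower border of $P$ whose abscissa equals that of the right edge of $u$; - $r(u)$ is the number of horizontal steps of the lower border of $P$ read leftwards from $X(u)$ before a vertical step or the bottom-left corner of $P$ is met. A Schröder slicing is a Baxter slicing in which every horizontal block $u$ satisfies $\ell(u)\le r(u)+1$. The large Schröder numbers $1,2,6,22,90,\ldots$ (for sizes $1,2,\ldots$) have generating function $\sum_{n\ge1}S_nx^{n-1}=(1-x-\sqrt{1-6x+x^2})/(2x)$. *)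

theory Defs
  imports
    Complex_Main
    "HOL-Library.Multiset"
    "HOL-Computational_Algebra.Formal_Power_Series"
begin

subsection \<open>Parallelogram polyominoes\<close>

text \<open>
  The pair \<open>(i, j)\<close> stands for the unit cell \<open>[i, i+1] \<times> [j, j+1]\<close>. Polyominoes are taken up to
  translation: the bottom-left corner of the bounding rectangle, where both border paths start,
  is the origin.
\<close>

type_synonym cell = "nat \<times> nat"

datatype step = East | North

definition path_point :: "step list \<Rightarrow> nat \<Rightarrow> nat \<times> nat" where
  "path_point w i = (count_list (take i w) East, count_list (take i w) North)"

definition path_points :: "step list \<Rightarrow> (nat \<times> nat) set" where
  "path_points w = path_point w ` {..length w}"

definition interior_cells :: "step list \<Rightarrow> step list \<Rightarrow> cell set" where
  "interior_cells U L =
     {(i, j). \<exists>a b. {(i, a), (Suc i, a)} \<subseteq> path_points L \<and>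
                    {(i, b), (Suc i, b)} \<subseteq> path_points U \<and> a \<le> j \<and> j < b}"

text \<open>
  \<open>P\<close> is the interior of the contour with upper border \<open>U\<close> and lower border \<open>L\<close>. That \<open>P\<close> is
  edge-connected is automatic, as the two paths have no inner common point. Nonemptiness
  excludes degenerate contours such as two equal paths of length at most one, as well as \<open>U\<close>
  running below \<open>L\<close>.
\<close>

definition contour :: "step list \<Rightarrow> step list \<Rightarrow> cell set \<Rightarrow> bool" where
  "contour U L P \<longleftrightarrow>
     path_point U (length U) = path_point L (length L) \<and>
     path_points U \<inter> path_points L = {(0, 0), path_point L (length L)} \<and>
     P = interior_cells U L \<and> P \<noteq> {}"

definition parallelogram_polyomino :: "cell set \<Rightarrow> bool" where
  "parallelogram_polyomino P \<longleftrightarrow> (\<exists>U L. contour U L P)"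

definition lower_border :: "cell set \<Rightarrow> step list" where
  "lower_border P = (THE L. \<exists>U. contour U L P)"

definition width :: "cell set \<Rightarrow> nat" where
  "width A = Suc (Max (fst ` A)) - Min (fst ` A)"

definition height :: "cell set \<Rightarrow> nat" where
  "height A = Suc (Max (snd ` A)) - Min (snd ` A)"

definition psize :: "cell set \<Rightarrow> nat" where
  "psize P = width P + height P - 1"

definition top_row :: "cell set \<Rightarrow> cell set" where
  "top_row P = {c \<in> P. snd c = Max (snd ` P)}"

definition right_column :: "cell set \<Rightarrow> cell set" where
  "right_column P = {c \<in> P. fst c = Max (fst ` P)}"

subsection \<open>Baxter and Schroeder slicings\<close>

text \<open>
  \<open>baxter n P D H\<close>: the set of blocks \<open>D\<close> is a Baxter slicing of size \<open>n\<close> of \<open>P\<close>, and \<open>H\<close> is the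
  set of its horizontal blocks. The initial cell is neither horizontal nor vertical; counting it
  as horizontal would not affect Schroeder slicings, since its width is 1. A top row sticking
  out to the right of the row below it cannot be removed, as this would decrease the size by
  more than 1; the same applies to columns.
\<close>

inductive baxter :: "nat \<Rightarrow> cell set \<Rightarrow> cell set set \<Rightarrow> cell set set \<Rightarrow> bool" where
  single: "parallelogram_polyomino P \<Longrightarrow> psize P = 1 \<Longrightarrow> baxter 1 P {P} {}"
| horizontal: "parallelogram_polyomino P \<Longrightarrow> psize P = Suc n \<Longrightarrow>
     baxter n (P - top_row P) D H \<Longrightarrow>
     baxter (Suc n) P (insert (top_row P) D) (insert (top_row P) H)"
| vertical: "parallelogram_polyomino P \<Longrightarrow> psize P = Suc n \<Longrightarrow>
     baxter n (P - right_column P) D H \<Longrightarrow>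
     baxter (Suc n) P (insert (right_column P) D) H"

type_synonym slicing = "cell set \<times> cell set set"

definition baxter_slicings :: "nat \<Rightarrow> slicing set" where
  "baxter_slicings n = {(P, D). \<exists>H. baxter n P D H}"

definition horizontal_blocks :: "slicing \<Rightarrow> cell set set" where
  "horizontal_blocks S = \<Union>{H. \<exists>n. baxter n (fst S) (snd S) H}"

definition X_point :: "cell set \<Rightarrow> cell set \<Rightarrow> nat \<times> nat" where
  "X_point P u =
     (let x = Suc (Max (fst ` u)) in (x, LEAST y. (x, y) \<in> path_points (lower_border P)))"

text \<open>
  A path from the origin reaches the point \<open>(x, y)\<close> after exactly \<open>x + y\<close> steps.
\<close>

definition r_stat :: "cell set \<Rightarrow> cell set \<Rightarrow> nat" where
  "r_stat P u =
     (case X_point P u of (x, y) \<Rightarrow>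
        length (takeWhile (\<lambda>s. s = East) (rev (take (x + y) (lower_border P)))))"

definition schroeder_slicings :: "nat \<Rightarrow> slicing set" where
  "schroeder_slicings n =
     {S \<in> baxter_slicings n. \<forall>u\<in>horizontal_blocks S. width u \<le> r_stat (fst S) u + 1}"

definition all_schroeder_slicings :: "slicing set" where
  "all_schroeder_slicings = (\<Union>n. schroeder_slicings n)"

subsection \<open>Growth of Schroeder slicings\<close>

definition add_block :: "cell set \<Rightarrow> slicing \<Rightarrow> slicing" where
  "add_block u S = (fst S \<union> u, insert u (snd S))"

definition new_rows :: "cell set \<Rightarrow> cell set set" where
  "new_rows P = {{width P - w..<width P} \<times> {height P} | w. 1 \<le> w \<and> w \<le> width P}"

definition new_columns :: "cell set \<Rightarrow> cell set set" where
  "new_columns P =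
     {{width P} \<times> {height P - j..<height P} | j. 1 \<le> j \<and> j \<le> height (right_column P)}"

definition slicing_children :: "slicing \<Rightarrow> slicing set" where
  "slicing_children S =
     {add_block u S | u. u \<in> new_rows (fst S) \<union> new_columns (fst S) \<and>
                         add_block u S \<in> all_schroeder_slicings}"

definition slicing_label :: "slicing \<Rightarrow> nat \<times> nat" where
  "slicing_label S =
     (Max {width u | u. u \<in> new_rows (fst S) \<and> add_block u S \<in> all_schroeder_slicings},
      height (right_column (fst S)))"

definition root_slicing :: slicing where
  "root_slicing = ({(0, 0)}, {{(0, 0)}})"

subsection \<open>Generating trees\<close>

record ('v, 'l) labelled_tree =
  nodes :: "'v set"
  root_node :: 'v
  children :: "'v \<Rightarrow> 'v set"
  label :: "'v \<Rightarrow> 'l"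

definition tree_iso :: "('v, 'l) labelled_tree \<Rightarrow> ('w, 'l) labelled_tree \<Rightarrow> bool" where
  "tree_iso T T' \<longleftrightarrow>
     (\<exists>f. bij_betw f (nodes T) (nodes T') \<and> f (root_node T) = root_node T' \<and>
          (\<forall>v\<in>nodes T. f ` children T v = children T' (f v) \<and> label T' (f v) = label T v))"

text \<open>
  The tree of the succession rule \<open>rule\<close> with root label \<open>a\<close>, where \<open>rule l\<close> lists the labels of
  the children of a node labelled \<open>l\<close>. A node is encoded by the indices of the children to follow
  from the root, the last index being the head of the list.
\<close>

fun node_label :: "'l \<Rightarrow> ('l \<Rightarrow> 'l list) \<Rightarrow> nat list \<Rightarrow> 'l" where
  "node_label a rule [] = a"
| "node_label a rule (i # v) = rule (node_label a rule v) ! i"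

inductive_set rule_nodes :: "'l \<Rightarrow> ('l \<Rightarrow> 'l list) \<Rightarrow> nat list set"
  for a :: 'l and rule :: "'l \<Rightarrow> 'l list" where
  "[] \<in> rule_nodes a rule"
| "v \<in> rule_nodes a rule \<Longrightarrow> i < length (rule (node_label a rule v)) \<Longrightarrow>
     i # v \<in> rule_nodes a rule"

definition rule_tree :: "'l \<Rightarrow> ('l \<Rightarrow> 'l list) \<Rightarrow> (nat list, 'l) labelled_tree" where
  "rule_tree a rule =
     \<lparr>nodes = rule_nodes a rule, root_node = [],
      children = (\<lambda>v. {i # v | i. i < length (rule (node_label a rule v))}),
      label = node_label a rule\<rparr>"

fun NewSch :: "nat \<times> nat \<Rightarrow> (nat \<times> nat) list" where
  "NewSch (h, k) =
     map (\<lambda>i. (i, k + 1)) [1..<h + 1] @ map (\<lambda>j. (2, j)) [1..<k] @ [(h + 1, k)]"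

definition T_Sch :: "(nat list, nat \<times> nat) labelled_tree" where
  "T_Sch = rule_tree (1, 1) NewSch"

definition schroeder_tree :: "(slicing, nat \<times> nat) labelled_tree" where
  "schroeder_tree =
     \<lparr>nodes = all_schroeder_slicings, root_node = root_slicing,
      children = slicing_children, label = slicing_label\<rparr>"

subsection \<open>Large Schroeder numbers\<close>

definition schroeder_gf :: "real fps" where
  "schroeder_gf =
     (1 - fps_X - fps_radical root 2 (1 - 6 * fps_X + fps_X ^ 2)) / (2 * fps_X)"

definition large_schroeder :: "nat \<Rightarrow> real" where
  "large_schroeder n = fps_nth schroeder_gf (n - 1)"

end

theory Submission
  imports Defs
begin

text \<open>
  A parallelogram polyomino is encoded by its columns: the \<open>i\<close>-th one occupies the heights
  \<open>l i, \<dots>, u i - 1\<close>, and the lower border is read off \<open>l\<close>. In this encoding, the statistic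
  \<open>r\<close> at abscissa \<open>i + 1\<close> is the length of the maximal run of equal values of \<open>l\<close> ending at \<open>i\<close>, so
  adding a block never changes it for earlier blocks. A new row of width \<open>w\<close> is admissible iff
  \<open>w\<close> is at most the width of the top row and at most \<open>r + 1\<close>, where \<open>r\<close> is taken at the right
  end; the labels of the children follow by inspection. The block containing the top right
  corner determines the parent of a slicing, so the slicings do form a tree.

  For the enumeration, a label \<open>(h, k)\<close> is replaced by \<open>s = h + k\<close>, which turns the rule into
  \<open>s \<mapsto> 3, \<dots>, s + 1, s + 1\<close>. With \<open>G\<close> the claimed generating function, satisfying
  \<open>G = 1 + x G + x G\<^sup>2\<close>, the generating function of the descendants of a node \<open>s\<close> is
  \<open>G ((1 + G) / 2)\<^bsup>s - 2\<^esup>\<close>, since both satisfy the same recurrence.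
\<close>

subsection \<open>Lattice paths\<close>

text \<open>
  The height of the \<open>i\<close>-th east step; beyond the last east step, the height of the end point.
\<close>

fun east_height :: "step list \<Rightarrow> nat \<Rightarrow> nat" where
  "east_height [] i = 0"
| "east_height (North # w) i = Suc (east_height w i)"
| "east_height (East # w) 0 = 0"
| "east_height (East # w) (Suc i) = east_height w i"

lemma east_height_ge: "count_list w East \<le> i \<Longrightarrow> east_height w i = count_list w North"
  by (induction w i rule: east_height.induct) auto

lemma east_height_Suc: "east_height w i \<le> east_height w (Suc i)"
  by (induction w i rule: east_height.induct) auto

lemma mono_east_height: "mono (east_height w)"
  by (simp add: mono_iff_le_Suc east_height_Suc)

lemma path_points_Nil: "path_points [] = {(0, 0)}"
  by (auto simp: path_points_def path_point_def)

lemma path_points_Cons: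
  "path_points (s # w) =
     insert (0, 0) ((\<lambda>(x, y). if s = East then (Suc x, y) else (x, Suc y)) ` path_points w)"
proof -
  have "path_point (s # w) (Suc n) =
      (\<lambda>(x, y). if s = East then (Suc x, y) else (x, Suc y)) (path_point w n)" for n
    by (cases s) (auto simp: path_point_def)
  moreover have "{..length (s # w)} = insert 0 (Suc ` {..length w})"
    by (simp add: atMost_Suc_eq_insert_0)
  moreover have "path_point (s # w) 0 = (0, 0)"
    by (simp add: path_point_def)
  ultimately show ?thesis
    unfolding path_points_def by (simp add: image_image)
qed

text \<open>The points of abscissa \<open>x\<close> fill the vertical segment between the east step
  arriving at \<open>x\<close> and the one leaving it. At \<open>x = 0\<close> no step arrives and
  the segment starts at height 0; at the last abscissa \<open>east_height\<close> returns the end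
  height, so the final climb is included.\<close>

lemma mem_path_points:
  "(x, y) \<in> path_points w \<longleftrightarrow>
     x \<le> count_list w East \<and> y \<le> east_height w x \<and> (x > 0 \<longrightarrow> east_height w (x - 1) \<le> y)"
proof (induction w arbitrary: x y)
  case Nil
  then show ?case by (auto simp: path_points_Nil)
next
  case (Cons s w)
  show ?case
  proof (cases s)
    case East
    have "(x, y) \<in> path_points (s # w) \<longleftrightarrow>
        (x = 0 \<and> y = 0) \<or> (\<exists>x'. x = Suc x' \<and> (x', y) \<in> path_points w)"
      by (auto simp: path_points_Cons East)
    then show ?thesis
      using East by (cases x; cases "x - 1") (auto simp: Cons.IH)
  next
    case North
    have "(x, y) \<in> path_points (s # w) \<longleftrightarrow>
        (x = 0 \<and> y = 0) \<or> (\<exists>y'. y = Suc y' \<and> (x, y') \<in> path_points w)"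
      by (auto simp: path_points_Cons North)
    then show ?thesis
      using North by (cases y) (auto simp: Cons.IH)
  qed
qed

lemma horizontal_step_path_points:
  "{(i, a), (Suc i, a)} \<subseteq> path_points w \<longleftrightarrow> i < count_list w East \<and> a = east_height w i"
  using east_height_Suc[of w i] monoD[OF mono_east_height, of "i - 1" i w]
  by (auto simp: mem_path_points)

text \<open>The index just past the last east step is included on purpose: it fixes the total number
  of north steps, hence the final climb.\<close>

lemma path_eqI:
  "count_list w East = count_list w' East \<Longrightarrow>
     (\<And>i. i \<le> count_list w East \<Longrightarrow> east_height w i = east_height w' i) \<Longrightarrow> w = w'"
proof (induction w arbitrary: w')
  case Nil
  then show ?case
    using Nil.prems(2)[of 0] by (cases w'; cases "hd w'") auto
next
  case (Cons s w)
  note IH = Cons.IH and p = Cons.prems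
  obtain s' v where w': "w' = s' # v"
    using p(1) p(2)[of 0] by (cases w'; cases s) auto
  show ?case
  proof (cases s; cases s')
    assume s: "s = East" "s' = East"
    have "east_height w i = east_height v i" if "i \<le> count_list w East" for i
      using p(2)[of "Suc i"] that by (simp add: s w')
    then show ?thesis using IH[of v] p(1) by (simp add: s w')
  next
    assume s: "s = North" "s' = North"
    then show ?thesis using IH[of v] p by (simp add: s w')
  qed (use p(2)[of 0] w' in auto)
qed

lemma path_point_length: "path_point w (length w) = (count_list w East, count_list w North)"
  by (simp add: path_point_def)

section \<open>Paths with prescribed heights of the east steps\<close>

primrec border :: "(nat \<Rightarrow> nat) \<Rightarrow> nat \<Rightarrow> nat \<Rightarrow> step list" where
  "border l 0 m = replicate m North"
| "border l (Suc n) m = border l n (l n) @ East # replicate (m - l n) North"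

lemma east_height_append:
  "east_height (v @ w) i =
     (if i < count_list v East then east_height v i
      else count_list v North + east_height w (i - count_list v East))"
  by (induction v i rule: east_height.induct) auto

lemma count_list_replicate: "count_list (replicate n x) y = (if x = y then n else 0)"
  by (induction n) auto

lemma east_height_replicate: "east_height (replicate m North) i = m"
  by (induction m) auto

lemma border_props:
  assumes "mono_on {..<n} l" and "\<And>i. i < n \<Longrightarrow> l i \<le> m"
  shows "count_list (border l n m) East = n \<and> count_list (border l n m) North = m \<and>
         (\<forall>i. east_height (border l n m) i = (if i < n then l i else m))"
  using assms
proof (induction n arbitrary: m)
  case 0
  then show ?case by (simp add: count_list_replicate east_height_replicate)
next
  case (Suc n)
  have "mono_on {..<n} l" and "\<And>i. i < n \<Longrightarrow> l i \<le> l n"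
    using Suc.prems(1) by (auto simp: monotone_on_def)
  note IH = Suc.IH[OF this]
  have e: "east_height (East # replicate k North) i = (if i = 0 then 0 else k)" for i k
    by (cases i) (auto simp: east_height_replicate)
  show ?case
    using IH Suc.prems(2)[of n]
    by (auto simp: count_list_replicate e east_height_append less_Suc_eq)
qed

subsection \<open>Polyominoes as sequences of columns\<close>

text \<open>The condition \<open>l 0 = 0\<close> fixes the translation. The condition
  \<open>l (Suc i) < u i\<close> makes neighbouring columns share a row; it expresses
  edge-connectedness and keeps the two border paths apart at inner abscissas.\<close>

definition column_form :: "cell set \<Rightarrow> nat \<Rightarrow> (nat \<Rightarrow> nat) \<Rightarrow> (nat \<Rightarrow> nat) \<Rightarrow> bool" where
  "column_form P n l u \<longleftrightarrow>
     0 < n \<and> l 0 = 0 \<and> mono_on {..<n} l \<and> mono_on {..<n} u \<and> (\<forall>i<n. l i < u i) \<and>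
     (\<forall>i. Suc i < n \<longrightarrow> l (Suc i) < u i) \<and> P = {(i, j). i < n \<and> l i \<le> j \<and> j < u i}"

lemma interior_cells_eq:
  "interior_cells U L =
     {(i, j). i < count_list U East \<and> i < count_list L East \<and>
              east_height L i \<le> j \<and> j < east_height U i}"
  unfolding interior_cells_def horizontal_step_path_points by auto

text \<open>At an inner abscissa the vertical segments of the two borders are disjoint, so one lies
  strictly above the other. A cell of the interior shows that the upper border is the higher one
  somewhere, and this order propagates to both sides.\<close>

lemma contour_imp_column_form:
  assumes "contour U L P"
  shows "count_list U East = count_list L East"
    and "count_list L North = east_height U (count_list L East - 1)"
    and "column_form P (count_list L East) (east_height L) (east_height U)"
proof -
  define n where "n = count_list L East"
  define m where "m = count_list L North"
  let ?l = "east_height L" and ?u = "east_height U"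
  have n: "count_list U East = n" and m: "count_list U North = m"
    and int: "path_points U \<inter> path_points L = {(0, 0), (n, m)}"
    and P: "P = {(i, j). i < n \<and> ?l i \<le> j \<and> j < ?u i}" and ne: "P \<noteq> {}"
    using assms by (auto simp: contour_def interior_cells_eq path_point_length n_def m_def)
  have mono: "?l i \<le> ?l j" "?u i \<le> ?u j" if "i \<le> j" for i j
    using that monoD[OF mono_east_height] by auto
  have end_l: "?l n = m" and end_u: "?u n = m"
    using east_height_ge[of L n] east_height_ge[of U n] n m by (auto simp: n_def m_def)
  obtain i0 where i0: "i0 < n" "?l i0 < ?u i0" using ne P by auto
  \<comment> \<open>A height in both vertical segments at abscissa \<open>x\<close> gives a common
    point of the paths, hence one of the two end points.\<close>
  have meet: "x = 0 \<and> y = 0 \<or> x = n \<and> y = m" if "x \<le> n" "y \<le> ?l x" "y \<le> ?u x"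
    "x > 0 \<Longrightarrow> ?l (x - 1) \<le> y" "x > 0 \<Longrightarrow> ?u (x - 1) \<le> y" for x y
  proof -
    have "(x, y) \<in> path_points U \<inter> path_points L"
      using that n by (auto simp: mem_path_points n_def)
    then show ?thesis using int by auto
  qed
  have sep: "?l (Suc x) < ?u x \<or> ?u (Suc x) < ?l x" if "Suc x < n" for x
  proof -
    have "\<not> (?u x \<le> ?l x \<and> ?l x \<le> ?u (Suc x))"
      using meet[of "Suc x" "?l x"] that mono[of x "Suc x"] by auto
    moreover have "\<not> (?l x \<le> ?u x \<and> ?u x \<le> ?l (Suc x))"
      using meet[of "Suc x" "?u x"] that mono[of x "Suc x"] by auto
    ultimately show ?thesis by linarith
  qed
  \<comment> \<open>A reversal of the order between neighbouring abscissas would force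
    \<open>?u\<close> to decrease; in \<open>bwd\<close> below it would force \<open>?l\<close> to
    decrease.\<close>
  have fwd: "?l (Suc (Suc x)) < ?u (Suc x)" if "?l (Suc x) < ?u x" "Suc (Suc x) < n" for x
    using sep[of "Suc x"] that mono(2)[of x "Suc (Suc x)"] by auto
  have bwd: "?l (Suc x) < ?u x" if "?l (Suc (Suc x)) < ?u (Suc x)" "Suc (Suc x) < n" for x
    using sep[of x] that mono(1)[of x "Suc (Suc x)"] by auto
  have up: "?l (Suc x) < ?u x" if "i0 \<le> x" "Suc x < n" for x
    using that
  proof (induction x rule: dec_induct)
    case base
    then show ?case using sep[of i0] i0 mono(2)[of i0 "Suc i0"] by auto
  next
    case (step x)
    then show ?case using fwd[of x] by auto
  qed
  have down: "?l (Suc x) < ?u x" if "Suc x \<le> i0" for x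
    using that
  proof (induction "i0 - Suc x" arbitrary: x)
    case 0
    then have "i0 = Suc x" by simp
    then show ?case using sep[of x] i0 mono(1)[of x "Suc x"] by auto
  next
    case (Suc d)
    then show ?case using bwd[of x] i0(1) by auto
  qed
  have above: "?l (Suc x) < ?u x" if "Suc x < n" for x
    using up[of x] down[of x] that by (cases "i0 \<le> x") auto
  have lt: "?l x < ?u x" if "x < n" for x
  proof (cases "Suc x < n")
    case True
    then show ?thesis using above[of x] mono(1)[of x "Suc x"] by auto
  next
    \<comment> \<open>The last column has no right neighbour: its order comes from the column before
      it, or from \<open>i0\<close> if it is the only one.\<close>
    case False
    then show ?thesis using above[of "x - 1"] i0 mono(2)[of "x - 1" x] that
      by (cases x; cases i0) auto
  qed
  \<comment> \<open>At abscissa 0 both segments start at height 0, so the lower of their top ends is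
    a common point and must be the origin. The argument at abscissa \<open>n\<close>, where both
    segments end at \<open>m\<close>, is symmetric.\<close>
  have "?l 0 = 0 \<or> ?u 0 = 0"
    using meet[of 0 "?l 0"] meet[of 0 "?u 0"] i0(1) by (cases "?l 0 \<le> ?u 0") auto
  then have l0: "?l 0 = 0"
    using lt[of 0] i0(1) by auto
  have "?l (n - 1) = m \<or> ?u (n - 1) = m"
    using meet[of n "?l (n - 1)"] meet[of n "?u (n - 1)"] i0(1) mono[of "n - 1" n] end_l end_u
    by (cases "?l (n - 1) \<le> ?u (n - 1)") auto
  then have un: "?u (n - 1) = m"
    using lt[of "n - 1"] i0(1) mono(2)[of "n - 1" n] end_u by auto
  show "count_list U East = count_list L East"
    using n by (simp add: n_def)
  show "count_list L North = ?u (count_list L East - 1)"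
    using un by (simp add: n_def m_def)
  have "column_form P n ?l ?u"
    unfolding column_form_def
    using l0 lt above P i0 mono by (auto simp: monotone_on_def)
  then show "column_form P (count_list L East) ?l ?u"
    by (simp add: n_def)
qed

lemma column_formD:
  assumes "column_form P n l u"
  shows "0 < n" "l 0 = 0" "\<And>i j. i \<le> j \<Longrightarrow> j < n \<Longrightarrow> l i \<le> l j"
    "\<And>i j. i \<le> j \<Longrightarrow> j < n \<Longrightarrow> u i \<le> u j" "\<And>i. i < n \<Longrightarrow> l i < u i"
    "\<And>i. Suc i < n \<Longrightarrow> l (Suc i) < u i" "P = {(i, j). i < n \<and> l i \<le> j \<and> j < u i}"
    "\<And>i. i < n \<Longrightarrow> l i < u (n - 1)" "0 < u (n - 1)"
    "\<And>i. i < n \<Longrightarrow> u i \<le> u (n - 1)"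
proof -
  show *: "0 < n" "l 0 = 0" "\<And>i j. i \<le> j \<Longrightarrow> j < n \<Longrightarrow> l i \<le> l j"
    "\<And>i j. i \<le> j \<Longrightarrow> j < n \<Longrightarrow> u i \<le> u j" "\<And>i. i < n \<Longrightarrow> l i < u i"
    "\<And>i. Suc i < n \<Longrightarrow> l (Suc i) < u i" "P = {(i, j). i < n \<and> l i \<le> j \<and> j < u i}"
    using assms by (auto simp: column_form_def monotone_on_def)
  show **: "l i < u (n - 1)" if "i < n" for i
    using *(5)[OF that] *(4)[of i "n - 1"] that by linarith
  show "0 < u (n - 1)"
    using **[of 0] *(1) by simp
  show "u i \<le> u (n - 1)" if "i < n" for i
    using *(4)[of i "n - 1"] that by linarith
qed

text \<open>The lower path meets abscissa 0 only at the origin, and the upper path meets abscissa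
  \<open>n\<close> only at the end point. In between, \<open>l (Suc i) < u i\<close> leaves no
  height for a common point.\<close>

lemma column_form_imp_contour:
  assumes "column_form P n l u"
  shows "contour (border u n (u (n - 1))) (border l n (u (n - 1))) P"
proof -
  note cf = column_formD[OF assms]
  let ?m = "u (n - 1)"
  let ?U = "border u n ?m" and ?L = "border l n ?m"
  have ml: "mono_on {..<n} l" and mu: "mono_on {..<n} u"
    using assms by (auto simp: column_form_def)
  have L: "count_list ?L East = n" "count_list ?L North = ?m"
    "\<And>i. east_height ?L i = (if i < n then l i else ?m)"
    using border_props[OF ml less_imp_le[OF cf(8)]] by blast+
  have U: "count_list ?U East = n" "count_list ?U North = ?m"
    "\<And>i. east_height ?U i = (if i < n then u i else ?m)"
    using border_props[OF mu cf(10)] by blast+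
  have memL: "(x, y) \<in> path_points ?L \<longleftrightarrow> x \<le> n \<and> y \<le> (if x < n then l x else ?m) \<and>
      (0 < x \<longrightarrow> (if x - 1 < n then l (x - 1) else ?m) \<le> y)" for x y
    unfolding mem_path_points L ..
  have memU: "(x, y) \<in> path_points ?U \<longleftrightarrow> x \<le> n \<and> y \<le> (if x < n then u x else ?m) \<and>
      (0 < x \<longrightarrow> (if x - 1 < n then u (x - 1) else ?m) \<le> y)" for x y
    unfolding mem_path_points U ..
  have "(x = 0 \<and> y = 0) \<or> (x = n \<and> y = ?m)"
    if "(x, y) \<in> path_points ?U" "(x, y) \<in> path_points ?L" for x y
  proof -
    note xyU = that(1)[unfolded memU] and xyL = that(2)[unfolded memL]
    consider "x = 0" | x' where "x = Suc x'" "x < n" | "x = n" "0 < x"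
      using xyU by (cases x) (auto simp: le_less)
    then show ?thesis
    proof cases
      case 1
      then show ?thesis using xyL cf(1,2) by simp
    next
      case 2
      then show ?thesis using xyL xyU cf(6)[of x'] by simp
    next
      case 3
      then show ?thesis using xyU by simp
    qed
  qed
  moreover have "(0, 0) \<in> path_points w" for w
    by (cases w) (auto simp: path_points_Nil path_points_Cons)
  moreover have "(n, ?m) \<in> path_points ?U" "(n, ?m) \<in> path_points ?L"
    using cf(8)[of "n - 1"] cf(1) unfolding memU memL by simp_all
  ultimately have pts: "path_points ?U \<inter> path_points ?L = {(0, 0), (n, ?m)}"
    by auto
  moreover have "P = interior_cells ?U ?L"
    unfolding interior_cells_eq cf(7) U L by auto
  moreover have "(0, 0) \<in> P"
    using cf(1,2) cf(5)[of 0] by (simp add: cf(7))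
  ultimately show ?thesis
    unfolding contour_def path_point_length U L by blast
qed

lemma parallelogram_polyomino_iff: "parallelogram_polyomino P \<longleftrightarrow> (\<exists>n l u. column_form P n l u)"
  using contour_imp_column_form(3) column_form_imp_contour
  unfolding parallelogram_polyomino_def by blast

lemma fst_image_column_form:
  assumes "column_form P n l u"
  shows "fst ` P = {..<n}"
proof -
  note cf = column_formD[OF assms]
  have "i \<in> fst ` P" if "i < n" for i
    using cf(5)[OF that] that by (auto simp: cf(7) image_iff)
  then show ?thesis by (auto simp: cf(7))
qed

text \<open>No height is skipped: one reached by column \<open>Suc k\<close> but not below
  \<open>u k\<close> lies above the bottom \<open>l (Suc k)\<close>, hence in that column.\<close>

lemma snd_image_column_form:
  assumes "column_form P n l u"
  shows "snd ` P = {..<u (n - 1)}"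
proof -
  note cf = column_formD[OF assms]
  have "\<exists>i<n. l i \<le> j \<and> j < u i" if "j < u k" "k < n" for j k
    using that
  proof (induction k)
    case 0
    then show ?case using cf(2) by auto
  next
    case (Suc k)
    then show ?case using cf(6)[of k] by (cases "j < u k") force+
  qed
  then have "\<exists>i<n. l i \<le> j \<and> j < u i" if "j < u (n - 1)" for j
    using that cf(1) by (meson diff_less zero_less_one)
  then have "{..<u (n - 1)} \<subseteq> snd ` P"
    by (fastforce simp: cf(7) image_iff simp del: One_nat_def)
  moreover have "j < u (n - 1)" if "i < n" "j < u i" for i j
    using cf(4)[of i "n - 1"] that by linarith
  ultimately show ?thesis
    by (auto simp: cf(7) simp del: One_nat_def)
qed

lemma Max_lessThan_nat: "0 < (n::nat) \<Longrightarrow> Max {..<n} = n - 1"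
  by (intro Max_eqI) auto

lemma Min_lessThan_nat: "0 < (n::nat) \<Longrightarrow> Min {..<n} = 0"
  by (intro Min_eqI) auto

lemma column_form_size:
  assumes "column_form P n l u"
  shows "Max (fst ` P) = n - 1" "Max (snd ` P) = u (n - 1) - 1"
    "width P = n" "height P = u (n - 1)" "psize P = n + u (n - 1) - 1"
proof -
  have pos: "0 < n" "0 < u (n - 1)"
    using column_formD[OF assms] by auto
  note * = fst_image_column_form[OF assms] snd_image_column_form[OF assms]
  show "Max (fst ` P) = n - 1" "Max (snd ` P) = u (n - 1) - 1"
    unfolding * using pos by (simp_all add: Max_lessThan_nat)
  show "width P = n" "height P = u (n - 1)"
    using pos by (simp_all add: width_def height_def * Max_lessThan_nat Min_lessThan_nat)
  then show "psize P = n + u (n - 1) - 1"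
    by (simp add: psize_def)
qed

text \<open>Each column is a nonempty interval, so its end points can be read off the cells of that
  abscissa; the number of columns is the width.\<close>

lemma column_form_unique:
  assumes "column_form P n l u" "column_form P n' l' u'"
  shows "n = n'" "\<And>i. i < n \<Longrightarrow> l i = l' i" "\<And>i. i < n \<Longrightarrow> u i = u' i"
proof -
  show n: "n = n'"
    using column_form_size(3)[OF assms(1)] column_form_size(3)[OF assms(2)] by simp
  fix i assume i: "i < n"
  note c = column_formD(7)[OF assms(1)] and c' = column_formD(7)[OF assms(2)]
  have "{l i..<u i} = Pair i -` P"
    using i by (auto simp: c)
  moreover have "{l' i..<u' i} = Pair i -` P"
    using i n by (auto simp: c')
  ultimately have "{l i..<u i} = {l' i..<u' i}" by simp
  then show "l i = l' i" "u i = u' i"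
    using atLeastLessThan_eq_iff[of "l i" "u i" "l' i" "u' i"]
      column_formD(5)[OF assms(1) i] column_formD(5)[OF assms(2)] i n by auto
qed

lemma lower_border_column_form:
  assumes "column_form P n l u"
  shows "lower_border P = border l n (u (n - 1))"
  unfolding lower_border_def
proof (rule the_equality)
  show "\<exists>U. contour U (border l n (u (n - 1))) P"
    using column_form_imp_contour[OF assms] by blast
next
  fix L assume "\<exists>U. contour U L P"
  then obtain U where U: "contour U L P" by blast
  note c = contour_imp_column_form[OF U]
  note eq = column_form_unique[OF assms c(3)]
  have ml: "mono_on {..<n} l" using assms by (simp add: column_form_def)
  have b: "count_list (border l n (u (n - 1))) East = n"
    "\<And>i. east_height (border l n (u (n - 1))) i = (if i < n then l i else u (n - 1))"
    using border_props[OF ml less_imp_le[OF column_formD(8)[OF assms]]] by blast+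
  show "L = border l n (u (n - 1))"
  proof (rule path_eqI)
    show "count_list L East = count_list (border l n (u (n - 1))) East"
      using eq(1) b(1) by simp
    fix i assume "i \<le> count_list L East"
    \<comment> \<open>At \<open>i = n\<close> both sides are the end height, which is the top of the
      last column.\<close>
    then show "east_height L i = east_height (border l n (u (n - 1))) i"
      unfolding b(2)
      using eq(1) eq(2)[of i] eq(3)[of "n - 1"] c(2) east_height_ge[of L n] column_formD(1)[OF assms]
      by auto
  qed
qed

section \<open>The statistic r as a run length of column bottoms\<close>

primrec run :: "(nat \<Rightarrow> nat) \<Rightarrow> nat \<Rightarrow> nat" where
  "run l 0 = 1"
| "run l (Suc i) = (if l (Suc i) = l i then Suc (run l i) else 1)"

lemma run_cong: "(\<And>j. j \<le> i \<Longrightarrow> l j = l' j) \<Longrightarrow> run l i = run l' i"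
  by (induction i) auto

lemma length_border:
  "mono_on {..<n} l \<Longrightarrow> (\<And>i. i < n \<Longrightarrow> l i \<le> m) \<Longrightarrow> length (border l n m) = n + m"
proof (induction n arbitrary: m)
  case (Suc n)
  have "length (border l n (l n)) = n + l n"
    using Suc.prems(1) by (intro Suc.IH) (auto simp: monotone_on_def)
  then show ?case using Suc.prems(2)[of n] by simp
qed simp

text \<open>The point \<open>(Suc i, l i)\<close> is reached after \<open>Suc i + l i\<close> steps.
  As \<open>border\<close> recurses on the last east step, the path up to that point is again a
  border, with an empty final climb.\<close>

lemma take_border:
  assumes "i < n" "mono_on {..<n} l" "\<And>i. i < n \<Longrightarrow> l i \<le> m"
  shows "take (Suc i + l i) (border l n m) = border l (Suc i) (l i)"
  using assms
proof (induction n arbitrary: m)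
  case 0
  then show ?case by simp
next
  case (Suc n)
  have m: "mono_on {..<n} l" "\<And>i. i < n \<Longrightarrow> l i \<le> l n"
    using Suc.prems(2) by (auto simp: monotone_on_def)
  have len: "length (border l n (l n)) = n + l n"
    by (rule length_border) (use m in auto)
  show ?case
  proof (cases "i = n")
    case True
    then show ?thesis using len by simp
  next
    case False
    then have "i < n" using Suc.prems(1) by simp
    then show ?thesis
      using Suc.IH[OF _ m] len m(2)[of i] by simp
  qed
qed

text \<open>Read backwards, the path first shows the east step of column \<open>i\<close>. Before it
  comes another east step if the bottoms of columns \<open>i - 1\<close> and \<open>i\<close> agree,
  a north step if they differ, and the corner if \<open>i = 0\<close>.\<close>

lemma takeWhile_border:
  assumes "mono_on {..i} l" "l 0 = 0"
  shows "length (takeWhile (\<lambda>s. s = East) (rev (border l (Suc i) (l i)))) = run l i"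
  using assms
proof (induction i)
  case 0
  then show ?case by simp
next
  case (Suc i)
  have "mono_on {..i} l" and le: "l i \<le> l (Suc i)"
    using Suc.prems(1) by (auto simp: monotone_on_def)
  note IH = Suc.IH[OF this(1) Suc.prems(2)]
  show ?case
  proof (cases "l (Suc i) = l i")
    case True
    then show ?thesis using IH by simp
  next
    case False
    then obtain k where "l (Suc i) - l i = Suc k"
      using le by (metis Suc_diff_Suc le_neq_implies_less)
    then show ?thesis using False by (simp add: replicate_app_Cons_same)
  qed
qed

lemma r_stat_column_form:
  assumes cf: "column_form P n l u" and i: "Max (fst ` B) = i" "i < n"
  shows "r_stat P B = run l i"
proof -
  let ?L = "border l n (u (n - 1))"
  note c = column_formD[OF cf]
  have ml: "mono_on {..<n} l" using cf by (simp add: column_form_def)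
  have "mono_on {..i} l" using ml i by (auto simp: monotone_on_def)
  note tw = takeWhile_border[OF this c(2)]
  have b: "count_list ?L East = n" "\<And>i. east_height ?L i = (if i < n then l i else u (n - 1))"
    using border_props[OF ml less_imp_le[OF c(8)]] by blast+
  have "(LEAST y. (Suc i, y) \<in> path_points ?L) = l i"
    using i(2) c(3)[of i "Suc i"] c(8)[of i]
    by (intro Least_equality) (auto simp: mem_path_points b simp del: One_nat_def)
  then have "X_point P B = (Suc i, l i)"
    by (simp add: X_point_def lower_border_column_form[OF cf] i)
  then show ?thesis
    using take_border[OF i(2) ml, of "u (n - 1)"] c(8) tw
    by (simp add: r_stat_def lower_border_column_form[OF cf] less_imp_le)
qed

subsection \<open>Adding and removing rows and columns\<close>

definition new_row :: "cell set \<Rightarrow> nat \<Rightarrow> cell set" where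
  "new_row P w = {width P - w..<width P} \<times> {height P}"

definition new_column :: "cell set \<Rightarrow> nat \<Rightarrow> cell set" where
  "new_column P j = {width P} \<times> {height P - j..<height P}"

lemma new_rows_eq: "new_rows P = new_row P ` {1..width P}"
  by (auto simp: new_rows_def new_row_def)

lemma new_columns_eq: "new_columns P = new_column P ` {1..height (right_column P)}"
  by (auto simp: new_columns_def new_column_def)

lemma column_form_mem: "column_form P n l u \<Longrightarrow> (i, j) \<in> P \<longleftrightarrow> i < n \<and> l i \<le> j \<and> j < u i"
  by (simp add: column_form_def)

lemma Max_atLeastLessThan_nat: "(a::nat) < b \<Longrightarrow> Max {a..<b} = b - 1"
  by (intro Max_eqI) auto

lemma Min_atLeastLessThan_nat: "(a::nat) < b \<Longrightarrow> Min {a..<b} = a"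
  by (intro Min_eqI) auto

lemma width_row: "width ({a..<b} \<times> {y}) = b - a" if "a < b"
  using that by (simp add: width_def Max_atLeastLessThan_nat Min_atLeastLessThan_nat)

lemma height_column: "height ({x} \<times> {a..<b}) = b - a" if "a < b"
  using that by (simp add: height_def Max_atLeastLessThan_nat Min_atLeastLessThan_nat)

lemma right_column_form:
  assumes "column_form P n l u"
  shows "right_column P = {n - 1} \<times> {l (n - 1)..<u (n - 1)}"
    and "height (right_column P) = u (n - 1) - l (n - 1)"
proof -
  note c = column_formD[OF assms]
  show eq: "right_column P = {n - 1} \<times> {l (n - 1)..<u (n - 1)}"
    unfolding right_column_def column_form_size(1)[OF assms] using c(1) by (auto simp: c(7))
  show "height (right_column P) = u (n - 1) - l (n - 1)"
    unfolding eq by (rule height_column) (use c(1) c(5) in simp)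
qed

lemma top_row_form:
  assumes "column_form P n l u"
  obtains t where "t < n" "\<And>i. i < n \<Longrightarrow> u i = u (n - 1) \<longleftrightarrow> t \<le> i"
    "top_row P = {t..<n} \<times> {u (n - 1) - 1}" "width (top_row P) = n - t"
proof -
  note c = column_formD[OF assms]
  define t where "t = (LEAST i. u i = u (n - 1))"
  have t: "u t = u (n - 1)" "t \<le> n - 1"
    unfolding t_def by (rule LeastI[of _ "n - 1"], simp) (rule Least_le, simp)
  then have tn: "t < n" using c(1) by linarith
  have iff: "u i = u (n - 1) \<longleftrightarrow> t \<le> i" if "i < n" for i
  proof
    assume "u i = u (n - 1)"
    then show "t \<le> i" unfolding t_def by (rule Least_le)
  next
    assume "t \<le> i"
    then show "u i = u (n - 1)"
      using c(4)[of t i] c(10)[of i] that t by linarith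
  qed
  have "(i, j) \<in> top_row P \<longleftrightarrow> t \<le> i \<and> i < n \<and> j = u (n - 1) - 1" for i j
  proof (cases "i < n")
    case True
    have "(i, j) \<in> top_row P \<longleftrightarrow> l i \<le> j \<and> j < u i \<and> j = u (n - 1) - 1"
      using True column_form_size(2)[OF assms] by (auto simp: top_row_def c(7))
    also have "\<dots> \<longleftrightarrow> u i = u (n - 1) \<and> j = u (n - 1) - 1"
      using c(5)[OF True] c(10)[OF True] by auto
    finally show ?thesis using iff[OF True] True by auto
  qed (auto simp: top_row_def c(7))
  then have eq: "top_row P = {t..<n} \<times> {u (n - 1) - 1}"
    by auto
  then show thesis using that[of t] tn iff width_row[OF tn] by simp
qed

text \<open>The bound on \<open>w\<close> means that the new row rests on columns of full height
  only, so every raised column stays an interval and gains one cell.\<close>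

lemma
  assumes cf: "column_form P n l u" and w: "0 < w" "w \<le> width (top_row P)"
  shows column_form_add_row:
      "column_form (P \<union> new_row P w) n l (\<lambda>i. if n - w \<le> i then Suc (u i) else u i)"
    and top_row_add_row: "top_row (P \<union> new_row P w) = new_row P w"
    and width_new_row: "width (new_row P w) = w"
proof -
  note c = column_formD[OF cf]
  let ?u = "\<lambda>i. if n - w \<le> i then Suc (u i) else u i"
  obtain t where t: "t < n" "\<And>i. i < n \<Longrightarrow> u i = u (n - 1) \<longleftrightarrow> t \<le> i" "width (top_row P) = n - t"
    using top_row_form[OF cf] by metis
  have row: "new_row P w = {n - w..<n} \<times> {u (n - 1)}"
    by (simp add: new_row_def column_form_size[OF cf])
  have tw: "t \<le> n - w" "w \<le> n" using w t by linarith+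
  have top: "u i = u (n - 1)" if "n - w \<le> i" "i < n" for i
    using t(2)[of i] tw that by auto
  have "(i, j) \<in> P \<union> new_row P w \<longleftrightarrow> i < n \<and> l i \<le> j \<and> j < ?u i" for i j
    using c(8)[of i] top[of i]
    by (auto simp: column_form_mem[OF cf] row less_Suc_eq simp del: One_nat_def)
  then have "P \<union> new_row P w = {(i, j). i < n \<and> l i \<le> j \<and> j < ?u i}"
    by auto
  moreover have "mono_on {..<n} ?u"
    using c(4) by (auto simp: monotone_on_def le_SucI)
  moreover have "\<forall>i<n. l i < ?u i"
    using c(5) by (auto simp: less_SucI)
  moreover have "\<forall>i. Suc i < n \<longrightarrow> l (Suc i) < ?u i"
    using c(6) by (auto simp: less_SucI)
  ultimately show cf': "column_form (P \<union> new_row P w) n l ?u"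
    using cf by (auto simp: column_form_def)
  obtain t' where t': "t' < n" "\<And>i. i < n \<Longrightarrow> ?u i = ?u (n - 1) \<longleftrightarrow> t' \<le> i"
    "top_row (P \<union> new_row P w) = {t'..<n} \<times> {?u (n - 1) - 1}"
    by (rule top_row_form[OF cf'], rule that)
  have last: "?u (n - 1) = Suc (u (n - 1))"
    using w by auto
  have nw: "n - w < n" using w c(1) by simp
  have "t' = n - w"
  proof (rule antisym)
    show "t' \<le> n - w"
      using t'(2)[OF nw] top[OF _ nw] unfolding last by simp
    have "?u t' = Suc (u (n - 1))" using t'(2)[OF t'(1)] last by simp
    then show "n - w \<le> t'"
      using c(10)[OF t'(1)] by (auto split: if_splits)
  qed
  then show "top_row (P \<union> new_row P w) = new_row P w"
    unfolding t'(3) unfolding row last by simp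
  show "width (new_row P w) = w"
    unfolding row using width_row[OF nw] tw by simp
qed

text \<open>The column bottoms \<open>l\<close> are untouched, so the runs that compute
  \<open>r\<close> do not change. The right column and the new row end at the same abscissa and
  hence share their value of \<open>r\<close>.\<close>

lemma
  assumes cf: "column_form P n l u" and w: "0 < w" "w \<le> width (top_row P)"
  shows psize_add_row: "psize (P \<union> new_row P w) = Suc (psize P)"
    and height_right_column_add_row:
      "height (right_column (P \<union> new_row P w)) = Suc (height (right_column P))"
    and r_stat_add_row: "Max (fst ` B) < n \<Longrightarrow> r_stat (P \<union> new_row P w) B = r_stat P B"
    and r_stat_right_column_add_row:
      "r_stat (P \<union> new_row P w) (right_column (P \<union> new_row P w)) = r_stat P (right_column P)"
    and r_stat_new_row: "r_stat (P \<union> new_row P w) (new_row P w) = r_stat P (right_column P)"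
proof -
  note c = column_formD[OF cf]
  note cf' = column_form_add_row[OF assms]
  have le: "n - w \<le> n - 1" using w by simp
  show "psize (P \<union> new_row P w) = Suc (psize P)"
    using le c(1) by (simp add: column_form_size(5)[OF cf'] column_form_size(5)[OF cf])
  show "height (right_column (P \<union> new_row P w)) = Suc (height (right_column P))"
    using le c(8)[of "n - 1"] c(1)
    by (simp add: right_column_form(2)[OF cf'] right_column_form(2)[OF cf] Suc_diff_le)
  show r: "r_stat (P \<union> new_row P w) B = r_stat P B" if "Max (fst ` B) < n" for B
    using r_stat_column_form[OF cf refl that] r_stat_column_form[OF cf' refl that] by simp
  have 1: "Max (fst ` right_column P) = n - 1"
    using c(8)[of "n - 1"] c(1) by (simp add: right_column_form(1)[OF cf])
  have 2: "Max (fst ` right_column (P \<union> new_row P w)) = n - 1"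
    using column_formD(5)[OF cf', of "n - 1"] c(1) by (simp add: right_column_form(1)[OF cf'])
  have 3: "Max (fst ` new_row P w) = n - 1"
    using c(1) w by (simp add: new_row_def column_form_size(3)[OF cf] Max_atLeastLessThan_nat)
  have lt: "n - 1 < n" using c(1) by simp
  show "r_stat (P \<union> new_row P w) (right_column (P \<union> new_row P w)) = r_stat P (right_column P)"
    "r_stat (P \<union> new_row P w) (new_row P w) = r_stat P (right_column P)"
    using r_stat_column_form[OF cf 1 lt] r_stat_column_form[OF cf' 2 lt]
      r_stat_column_form[OF cf' 3 lt] by simp_all
qed

text \<open>Top alignment puts the new bottom at \<open>u (n - 1) - j\<close>. By the bound on
  \<open>j\<close> it is not below the previous bottom, which keeps the bottoms monotone.\<close>

lemma
  assumes cf: "column_form P n l u" and j: "0 < j" "j \<le> height (right_column P)"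
  shows column_form_add_column:
      "column_form (P \<union> new_column P j) (Suc n) (l(n := u (n - 1) - j)) (u(n := u (n - 1)))"
    and right_column_add_column: "right_column (P \<union> new_column P j) = new_column P j"
    and height_new_column: "height (new_column P j) = j"
proof -
  note c = column_formD[OF cf]
  let ?l = "l(n := u (n - 1) - j)" and ?u = "u(n := u (n - 1))"
  have col: "new_column P j = {n} \<times> {u (n - 1) - j..<u (n - 1)}"
    by (simp add: new_column_def column_form_size[OF cf])
  have jl: "l (n - 1) \<le> u (n - 1) - j" "j \<le> u (n - 1)"
    using j c(8)[of "n - 1"] c(1) by (auto simp: right_column_form(2)[OF cf])
  have l: "l i \<le> u (n - 1) - j" if "i < n" for i
    using c(3)[of i "n - 1"] jl that by linarith
  have "P \<union> new_column P j = {(i, k). i < Suc n \<and> ?l i \<le> k \<and> k < ?u i}"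
    by (auto simp: column_form_mem[OF cf] col less_Suc_eq split: if_splits)
  moreover have "mono_on {..<Suc n} ?l"
    using c(3) l by (auto simp: monotone_on_def)
  moreover have "mono_on {..<Suc n} ?u"
    using c(4,10) by (auto simp: monotone_on_def)
  moreover have "\<forall>i<Suc n. ?l i < ?u i"
    using c(5) c(9) j by auto
  moreover have "\<forall>i. Suc i < Suc n \<longrightarrow> ?l (Suc i) < ?u i"
    using c(6) c(9) j by auto
  ultimately show cf': "column_form (P \<union> new_column P j) (Suc n) ?l ?u"
    using c(1,2) by (auto simp: column_form_def)
  show "right_column (P \<union> new_column P j) = new_column P j"
    unfolding right_column_form(1)[OF cf'] by (simp add: col)
  show "height (new_column P j) = j"
    unfolding col using j jl by (subst height_column) auto
qed

text \<open>Only a bottom at the new index \<open>n\<close> is added, so earlier runs are unchanged.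
  The run at \<open>n\<close> continues the previous one exactly when the new bottom equals the last
  one, that is, when the new column is as high as the right column; otherwise it starts afresh at
  1.\<close>

lemma
  assumes cf: "column_form P n l u" and j: "0 < j" "j \<le> height (right_column P)"
  shows psize_add_column: "psize (P \<union> new_column P j) = Suc (psize P)"
    and width_top_row_add_column:
      "width (top_row (P \<union> new_column P j)) = Suc (width (top_row P))"
    and r_stat_add_column: "Max (fst ` B) < n \<Longrightarrow> r_stat (P \<union> new_column P j) B = r_stat P B"
    and r_stat_right_column_add_column:
      "r_stat (P \<union> new_column P j) (right_column (P \<union> new_column P j)) =
        (if j = height (right_column P) then Suc (r_stat P (right_column P)) else 1)"
proof -
  note c = column_formD[OF cf]
  note cf' = column_form_add_column[OF assms]
  let ?l = "l(n := u (n - 1) - j)" and ?u = "u(n := u (n - 1))"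
  show "psize (P \<union> new_column P j) = Suc (psize P)"
    using c(1) by (simp add: column_form_size(5)[OF cf'] column_form_size(5)[OF cf])
  obtain t where t: "t < n" "\<And>i. i < n \<Longrightarrow> u i = u (n - 1) \<longleftrightarrow> t \<le> i" "width (top_row P) = n - t"
    using top_row_form[OF cf] by metis
  obtain t' where t': "t' < Suc n" "\<And>i. i < Suc n \<Longrightarrow> ?u i = ?u (Suc n - 1) \<longleftrightarrow> t' \<le> i"
    "width (top_row (P \<union> new_column P j)) = Suc n - t'"
    using top_row_form[OF cf'] by metis
  have "t' \<le> i \<longleftrightarrow> t \<le> i" if "i < n" for i
    using t(2)[OF that] t'(2)[of i] that by simp
  from this[of t] this[of t'] have "t' = t"
    using t(1) t'(1) by (cases "t' < n") auto
  then show "width (top_row (P \<union> new_column P j)) = Suc (width (top_row P))"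
    using t t' by simp
  have run: "run ?l i = run l i" if "i < n" for i
    using that by (intro run_cong) auto
  show "r_stat (P \<union> new_column P j) B = r_stat P B" if "Max (fst ` B) < n" for B
    using r_stat_column_form[OF cf refl that] r_stat_column_form[OF cf' refl, of B] that run
    by simp
  have 1: "Max (fst ` right_column P) = n - 1"
    using c(8)[of "n - 1"] c(1) by (simp add: right_column_form(1)[OF cf])
  have 2: "Max (fst ` right_column (P \<union> new_column P j)) = n"
    using column_formD(5)[OF cf', of n] by (simp add: right_column_form(1)[OF cf'])
  obtain n' where n': "n = Suc n'" using c(1) by (cases n) auto
  have eq: "u (n - 1) - j = l (n - 1) \<longleftrightarrow> j = height (right_column P)"
    using j c(8)[of "n - 1"] c(1) unfolding right_column_form(2)[OF cf] by linarith
  have "r_stat P (right_column P) = run l n'"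
    using r_stat_column_form[OF cf 1] n' by simp
  moreover have "r_stat (P \<union> new_column P j) (right_column (P \<union> new_column P j)) = run ?l n"
    using r_stat_column_form[OF cf' 2] by simp
  moreover have "run ?l n = (if u (n - 1) - j = l (n - 1) then Suc (run l n') else 1)"
    using run[of n'] n' by (auto simp del: fun_upd_apply simp: fun_upd_same fun_upd_other)
  ultimately show "r_stat (P \<union> new_column P j) (right_column (P \<union> new_column P j)) =
        (if j = height (right_column P) then Suc (r_stat P (right_column P)) else 1)"
    using eq by simp
qed

lemma width_top_row_pos: "column_form P n l u \<Longrightarrow> 0 < width (top_row P) \<and> width (top_row P) \<le> width P"
  by (rule top_row_form, assumption) (auto simp: column_form_size(3))

text \<open>Columns of a polyomino have no gaps: below the leftmost cell of the new row the old
  column must reach full height, so the row cannot extend to the left of the old top row.\<close>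

lemma add_row_bound:
  assumes cf: "column_form P n l u" and cf': "column_form (P \<union> new_row P w) n' l' u'"
    and w: "0 < w" "w \<le> width P"
  shows "w \<le> width (top_row P)"
proof -
  note c = column_formD[OF cf] and c' = column_formD[OF cf']
  obtain t where t: "t < n" "\<And>i. i < n \<Longrightarrow> u i = u (n - 1) \<longleftrightarrow> t \<le> i" "width (top_row P) = n - t"
    using top_row_form[OF cf] by metis
  have row: "new_row P w = {n - w..<n} \<times> {u (n - 1)}" and wn: "w \<le> n"
    using w by (simp_all add: new_row_def column_form_size[OF cf])
  let ?x = "n - w"
  have x: "?x < n" using w wn by simp
  have "(?x, l ?x) \<in> P \<union> new_row P w" "(?x, u (n - 1)) \<in> P \<union> new_row P w"
    using x c(5)[OF x] by (simp_all add: column_form_mem[OF cf] row)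
  then have "?x < n'" "l' ?x \<le> l ?x" "u (n - 1) < u' ?x"
    unfolding column_form_mem[OF cf'] by simp_all
  then have "(?x, u (n - 1) - 1) \<in> P \<union> new_row P w"
    using c(8)[OF x] unfolding column_form_mem[OF cf'] by linarith
  then have "u (n - 1) - 1 < u ?x"
    using c(9) by (auto simp: column_form_mem[OF cf] row)
  then have "u ?x = u (n - 1)"
    using c(10)[OF x] by linarith
  then show ?thesis using t(2)[OF x] t(3) wn by simp
qed

section \<open>Removing the top row or the right column\<close>

lemma column_form_subset_size:
  assumes "column_form P n l u" "column_form P' n' l' u'" "P' \<subseteq> P"
  shows "n' \<le> n" "u' (n' - 1) \<le> u (n - 1)"
proof -
  have "{..<n'} \<subseteq> {..<n}"
    using assms(3) image_mono[of P' P fst]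
    unfolding fst_image_column_form[OF assms(1)] fst_image_column_form[OF assms(2)] by simp
  then show "n' \<le> n" by simp
  have "{..<u' (n' - 1)} \<subseteq> {..<u (n - 1)}"
    using assms(3) image_mono[of P' P snd]
    unfolding snd_image_column_form[OF assms(1)] snd_image_column_form[OF assms(2)] by simp
  then show "u' (n' - 1) \<le> u (n - 1)" by simp
qed

text \<open>Removing the top row lowers the height and does not increase the width. A loss of
  exactly one in size then forces equal widths, so the row is right-aligned over the rest.\<close>

lemma top_row_in_new_rows:
  assumes cf: "column_form P n l u" and cf': "column_form (P - top_row P) n' l' u'"
    and size: "psize P = Suc (psize (P - top_row P))"
  shows "top_row P \<in> new_rows (P - top_row P)"
proof -
  let ?Q = "P - top_row P"
  note c = column_formD[OF cf] and c' = column_formD[OF cf']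
  obtain t where t: "t < n" "top_row P = {t..<n} \<times> {u (n - 1) - 1}"
    using top_row_form[OF cf] by metis
  have "j < u (n - 1) - 1" if "(i, j) \<in> ?Q" for i j
    using that c(10)[of i] column_form_size(2)[OF cf] by (fastforce simp: c(7) top_row_def)
  then have "snd ` ?Q \<subseteq> {..<u (n - 1) - 1}" by auto
  then have "u' (n' - 1) \<le> u (n - 1) - 1"
    unfolding snd_image_column_form[OF cf'] by simp
  moreover have "n' \<le> n" by (rule column_form_subset_size[OF cf cf']) auto
  ultimately have "n' = n" "u' (n' - 1) = u (n - 1) - 1"
    using size c(1,9) c'(1,9)
    unfolding column_form_size(5)[OF cf] column_form_size(5)[OF cf'] by linarith+
  then have "width ?Q = n" "height ?Q = u (n - 1) - 1"
    by (simp_all add: column_form_size[OF cf'])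
  then have "top_row P = new_row ?Q (n - t)" "n - t \<in> {1..width ?Q}"
    using t by (auto simp: new_row_def)
  then show ?thesis unfolding new_rows_eq by blast
qed

text \<open>Here the loss of one in size forces equal heights, so the column is top-aligned;
  monotone bottoms keep it from reaching below the last remaining column.\<close>

lemma right_column_in_new_columns:
  assumes cf: "column_form P n l u" and cf': "column_form (P - right_column P) n' l' u'"
    and size: "psize P = Suc (psize (P - right_column P))"
  shows "right_column P \<in> new_columns (P - right_column P)"
proof -
  let ?Q = "P - right_column P"
  note c = column_formD[OF cf] and c' = column_formD[OF cf']
  have "i < n - 1" if "(i, j) \<in> ?Q" for i j
    using that column_form_size(1)[OF cf] by (fastforce simp: c(7) right_column_def)
  then have "fst ` ?Q \<subseteq> {..<n - 1}" by auto
  then have "n' \<le> n - 1"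
    unfolding fst_image_column_form[OF cf'] by simp
  moreover have "u' (n' - 1) \<le> u (n - 1)" by (rule column_form_subset_size[OF cf cf']) auto
  ultimately have n: "n = Suc n'" "u' (n' - 1) = u (n - 1)"
    using size c(1,9) c'(1,9)
    unfolding column_form_size(5)[OF cf] column_form_size(5)[OF cf'] by linarith+
  have "(n' - 1, l (n' - 1)) \<in> ?Q"
    using c'(1) n(1) c(5)[of "n' - 1"] by (auto simp: right_column_form(1)[OF cf] column_form_mem[OF cf])
  then have "l' (n' - 1) \<le> l (n' - 1)"
    unfolding column_form_mem[OF cf'] by simp
  then have le: "l' (n' - 1) \<le> l n'"
    using c(3)[of "n' - 1" n'] n by simp
  have lt: "l n' < u n'" using c(5)[of n'] n by simp
  define j where "j = u n' - l n'"
  have "j \<in> {1..height (right_column ?Q)}"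
    using le lt n by (auto simp: j_def right_column_form(2)[OF cf'])
  moreover have "right_column P = new_column ?Q j"
    unfolding new_column_def column_form_size[OF cf'] unfolding right_column_form(1)[OF cf]
    using lt n by (simp add: j_def)
  ultimately show ?thesis unfolding new_columns_eq by blast
qed

lemma corner_mem:
  assumes "column_form P n l u"
  shows "(width P - 1, height P - 1) \<in> top_row P" "(width P - 1, height P - 1) \<in> right_column P"
proof -
  have "n - 1 < n" using column_formD(1)[OF assms] by simp
  then have "l (n - 1) \<le> u (n - 1) - 1" "u (n - 1) - 1 < u (n - 1)"
    using column_formD(8)[OF assms, of "n - 1"] column_formD(9)[OF assms] by linarith+
  then show "(width P - 1, height P - 1) \<in> top_row P" "(width P - 1, height P - 1) \<in> right_column P"
    using \<open>n - 1 < n\<close>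
    by (simp_all add: top_row_def right_column_def column_form_mem[OF assms] column_form_size[OF assms])
qed

text \<open>This tells a last horizontal block from a last vertical one. If the two coincide, the
  corner cell is the whole right column; a column to its left would share that row, reach full
  height as well and lengthen the top row.\<close>

lemma top_row_eq_right_column:
  assumes cf: "column_form P n l u" and eq: "top_row P = right_column P"
  shows "psize P = 1"
proof -
  note c = column_formD[OF cf]
  obtain t where t: "t < n" "\<And>i. i < n \<Longrightarrow> u i = u (n - 1) \<longleftrightarrow> t \<le> i"
    "top_row P = {t..<n} \<times> {u (n - 1) - 1}"
    using top_row_form[OF cf] by metis
  have lt: "l (n - 1) < u (n - 1)" using c(1,8) by simp
  have "(t, u (n - 1) - 1) \<in> right_column P" using t eq by auto
  then have tn: "t = n - 1" by (simp add: right_column_form(1)[OF cf])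
  have "(n - 1, l (n - 1)) \<in> top_row P"
    unfolding eq right_column_form(1)[OF cf] using lt by simp
  then have l: "l (n - 1) = u (n - 1) - 1" by (simp add: t)
  have "n = 1"
  proof (rule ccontr)
    assume "n \<noteq> 1"
    then have "Suc (n - 2) < n" and e: "Suc (n - 2) = n - 1" using c(1) by linarith+
    then have "u (n - 2) = u (n - 1)"
      using c(6)[of "n - 2"] c(10)[of "n - 2"] l unfolding e by linarith
    then have "t \<le> n - 2" using t(2)[of "n - 2"] \<open>Suc (n - 2) < n\<close> by simp
    then show False using tn e by linarith
  qed
  then show ?thesis using l c(2) c(9) by (simp add: column_form_size(5)[OF cf])
qed

subsection \<open>Slicings\<close>

text \<open>
  The maximal width of an addable row. As \<open>r_stat\<close> depends on a block only through the abscissa of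
  its right edge, the right column stands in for the row to be added.
\<close>

definition max_row :: "cell set \<Rightarrow> nat" where
  "max_row P = min (width (top_row P)) (Suc (r_stat P (right_column P)))"

lemma single_cell_column_form: "column_form {(0, 0)} 1 (\<lambda>_. 0) (\<lambda>_. 1)"
  by (auto simp: column_form_def monotone_on_def)

lemma psize_1:
  assumes "parallelogram_polyomino P" "psize P = 1"
  shows "P = {(0, 0)}"
proof -
  obtain n l u where cf: "column_form P n l u"
    using assms by (auto simp: parallelogram_polyomino_iff)
  note c = column_formD[OF cf]
  have "n = 1" "u (n - 1) = 1"
    using assms(2) c(1,9) unfolding column_form_size(5)[OF cf] by linarith+
  then show ?thesis using c(2,7) by auto
qed

section \<open>A slicing determines its horizontal blocks\<close>

lemma baxter_polyomino:
  "baxter n P D H \<Longrightarrow> parallelogram_polyomino P \<and> psize P = n \<and> 0 < n"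
  by (induction rule: baxter.induct) auto

lemma baxter_column_form: "baxter n P D H \<Longrightarrow> \<exists>l u. column_form P (width P) l u"
  using baxter_polyomino column_form_size(3) unfolding parallelogram_polyomino_iff by metis

lemma corner_mem_polyomino:
  assumes "parallelogram_polyomino P"
  shows "(width P - 1, height P - 1) \<in> top_row P" "(width P - 1, height P - 1) \<in> right_column P"
  using assms corner_mem unfolding parallelogram_polyomino_iff by blast+

lemma baxter_blocks: "baxter n P D H \<Longrightarrow> H \<subseteq> D \<and> (\<forall>B\<in>D. B \<subseteq> P \<and> B \<noteq> {})"
proof (induction rule: baxter.induct)
  case (single P)
  then show ?case using corner_mem_polyomino(1)[of P] by (auto simp: top_row_def)
next
  case (horizontal P n D H)
  then show ?case using corner_mem_polyomino(1)[of P] by (auto simp: top_row_def)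
next
  case (vertical P n D H)
  then show ?case using corner_mem_polyomino(2)[of P] by (auto simp: right_column_def)
qed

text \<open>
  A slicing has only one block through a given cell, here the top right corner \<open>c\<close>, so its last
  block can be recovered.
\<close>

lemma insert_block_eq:
  assumes "insert b D = insert b' D'" "c \<in> b" "c \<in> b'"
    and "\<And>B. B \<in> D \<Longrightarrow> B \<subseteq> P - b \<and> B \<noteq> {}" "\<And>B. B \<in> D' \<Longrightarrow> B \<subseteq> P - b' \<and> B \<noteq> {}"
  shows "b = b' \<and> D = D'"
proof -
  have "b = b'" using assms by blast
  moreover have "b \<notin> D" "b' \<notin> D'" using assms(4,5) by blast+
  ultimately show ?thesis using assms(1) by (metis insert_ident)
qed

text \<open>The last block is the one through the top right corner, so two derivations undo the same
  block. They could disagree on its kind only if the top row were the right column, which forces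
  size 1.\<close>

lemma baxter_unique: "baxter n P D H \<Longrightarrow> baxter m P D H' \<Longrightarrow> H = H'"
proof (induction arbitrary: m H' rule: baxter.induct)
  case (single P)
  from single(3) show ?case
  proof cases
    case single
    then show ?thesis by simp
  next
    case (horizontal k D' H'')
    then show ?thesis using single(2) baxter_polyomino by fastforce
  next
    case (vertical k D')
    then show ?thesis using single(2) baxter_polyomino by fastforce
  qed
next
  case (horizontal P n D H)
  note blocks = baxter_blocks[OF horizontal(3)]
  note c = corner_mem_polyomino[OF horizontal(1)]
  have n: "0 < n" using baxter_polyomino[OF horizontal(3)] by simp
  from horizontal(5) show ?case
  proof cases
    case single
    then show ?thesis using n horizontal(2) by simp
  next
    case h: (horizontal k D' H'')
    have "D = D'"
      using insert_block_eq[OF h(2) c(1) c(1), of P] blocks baxter_blocks[OF h(6)] by blast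
    then show ?thesis using horizontal(4)[of k H''] h by simp
  next
    case v: (vertical k D')
    have "top_row P = right_column P"
      using insert_block_eq[OF v(2) c, of P] blocks baxter_blocks[OF v(5)] by blast
    then show ?thesis
      using top_row_eq_right_column horizontal(1,2) n by (auto simp: parallelogram_polyomino_iff)
  qed
next
  case (vertical P n D H)
  note blocks = baxter_blocks[OF vertical(3)]
  note c = corner_mem_polyomino[OF vertical(1)]
  have n: "0 < n" using baxter_polyomino[OF vertical(3)] by simp
  from vertical(5) show ?case
  proof cases
    case single
    then show ?thesis using n vertical(2) by simp
  next
    case h: (horizontal k D' H'')
    have "right_column P = top_row P"
      using insert_block_eq[OF h(2) c(2,1), of P] blocks baxter_blocks[OF h(6)] by blast
    then show ?thesis
      using top_row_eq_right_column vertical(1,2) n by (auto simp: parallelogram_polyomino_iff)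
  next
    case v: (vertical k D')
    have "D = D'"
      using insert_block_eq[OF v(2) c(2) c(2), of P] blocks baxter_blocks[OF v(5)] by blast
    then show ?thesis using vertical(4)[of k H'] v by simp
  qed
qed

lemma horizontal_blocks_eq:
  assumes "baxter n P D H"
  shows "horizontal_blocks (P, D) = H"
proof -
  have "{H. \<exists>n. baxter n P D H} = {H}"
    using assms baxter_unique by blast
  then show ?thesis by (simp add: horizontal_blocks_def)
qed

lemma schroeder_slicings_iff:
  "(P, D) \<in> schroeder_slicings n \<longleftrightarrow>
     (\<exists>H. baxter n P D H \<and> (\<forall>u\<in>H. width u \<le> r_stat P u + 1))"
  by (auto simp: schroeder_slicings_def baxter_slicings_def horizontal_blocks_eq)

lemma Max_fst_less_width:
  assumes "column_form P n l u" "B \<subseteq> P" "B \<noteq> {}"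
  shows "Max (fst ` B) < n"
proof -
  have "fst ` B \<subseteq> {..<n}" using assms fst_image_column_form by blast
  then have "finite (fst ` B)" using finite_subset by blast
  then show ?thesis using \<open>fst ` B \<subseteq> {..<n}\<close> assms(3) by (subst Max_less_iff) auto
qed

section \<open>Children of a Schroeder slicing and their labels\<close>

lemma column_disjoint: "column_form P n l u \<Longrightarrow> P \<inter> new_column P j = {}"
  by (auto simp: new_column_def column_form_size column_form_mem)

lemma row_disjoint: "column_form P n l u \<Longrightarrow> P \<inter> new_row P j = {}"
  using column_formD(10) by (fastforce simp: new_row_def column_form_size column_form_mem)

lemma baxter_add_row:
  assumes "baxter n P D H" "0 < w" "w \<le> width (top_row P)"
  shows "baxter (Suc n) (P \<union> new_row P w) (insert (new_row P w) D) (insert (new_row P w) H)"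
proof -
  obtain k l u where cf: "column_form P k l u" using baxter_column_form[OF assms(1)] by blast
  let ?P = "P \<union> new_row P w"
  have "parallelogram_polyomino ?P"
    using column_form_add_row[OF cf assms(2,3)] parallelogram_polyomino_iff by blast
  moreover have "psize ?P = Suc n"
    using psize_add_row[OF cf assms(2,3)] baxter_polyomino[OF assms(1)] by simp
  moreover have "baxter n (?P - top_row ?P) D H"
    using assms(1) row_disjoint[OF cf] top_row_add_row[OF cf assms(2,3)]
    by (simp add: Un_Diff Diff_triv)
  ultimately show ?thesis
    using baxter.horizontal[of ?P n D H] top_row_add_row[OF cf assms(2,3)] by simp
qed

lemma baxter_add_column:
  assumes "baxter n P D H" "0 < j" "j \<le> height (right_column P)"
  shows "baxter (Suc n) (P \<union> new_column P j) (insert (new_column P j) D) H"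
proof -
  obtain k l u where cf: "column_form P k l u" using baxter_column_form[OF assms(1)] by blast
  let ?P = "P \<union> new_column P j"
  have "parallelogram_polyomino ?P"
    using column_form_add_column[OF cf assms(2,3)] parallelogram_polyomino_iff by blast
  moreover have "psize ?P = Suc n"
    using psize_add_column[OF cf assms(2,3)] baxter_polyomino[OF assms(1)] by simp
  moreover have "baxter n (?P - right_column ?P) D H"
    using assms(1) column_disjoint[OF cf] right_column_add_column[OF cf assms(2,3)]
    by (simp add: Un_Diff Diff_triv)
  ultimately show ?thesis
    using baxter.vertical[of ?P n D H] right_column_add_column[OF cf assms(2,3)] by simp
qed

lemma schroeder_add_column:
  assumes S: "(P, D) \<in> schroeder_slicings n" and j: "0 < j" "j \<le> height (right_column P)"
  shows "add_block (new_column P j) (P, D) \<in> schroeder_slicings (Suc n)"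
proof -
  obtain H where H: "baxter n P D H" "\<forall>u\<in>H. width u \<le> r_stat P u + 1"
    using S by (auto simp: schroeder_slicings_iff)
  obtain k l u where cf: "column_form P k l u" using baxter_column_form[OF H(1)] by blast
  have "r_stat (P \<union> new_column P j) B = r_stat P B" if "B \<in> H" for B
    using that baxter_blocks[OF H(1)]
    by (intro r_stat_add_column[OF cf j] Max_fst_less_width[OF cf]) auto
  then show ?thesis
    using baxter_add_column[OF H(1) j] H(2) by (auto simp: add_block_def schroeder_slicings_iff)
qed

lemma schroeder_add_row:
  assumes S: "(P, D) \<in> schroeder_slicings n" and w: "0 < w" "w \<le> max_row P"
  shows "add_block (new_row P w) (P, D) \<in> schroeder_slicings (Suc n)"
proof -
  obtain H where H: "baxter n P D H" "\<forall>u\<in>H. width u \<le> r_stat P u + 1"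
    using S by (auto simp: schroeder_slicings_iff)
  obtain k l u where cf: "column_form P k l u" using baxter_column_form[OF H(1)] by blast
  have w': "w \<le> width (top_row P)" using w by (simp add: max_row_def)
  have "r_stat (P \<union> new_row P w) B = r_stat P B" if "B \<in> H" for B
    using that baxter_blocks[OF H(1)]
    by (intro r_stat_add_row[OF cf w(1) w'] Max_fst_less_width[OF cf]) auto
  moreover have "width (new_row P w) \<le> r_stat (P \<union> new_row P w) (new_row P w) + 1"
    using w(2) unfolding width_new_row[OF cf w(1) w'] r_stat_new_row[OF cf w(1) w']
    by (simp add: max_row_def)
  ultimately show ?thesis
    using baxter_add_row[OF H(1) w(1) w'] H(2) by (auto simp: add_block_def schroeder_slicings_iff)
qed

lemma add_row_max_row:
  assumes S: "(P, D) \<in> schroeder_slicings n" and w: "0 < w" "w \<le> width P"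
    and ex: "add_block (new_row P w) (P, D) \<in> all_schroeder_slicings"
  shows "w \<le> max_row P"
proof -
  obtain H where H: "baxter n P D H" "\<forall>u\<in>H. width u \<le> r_stat P u + 1"
    using S by (auto simp: schroeder_slicings_iff)
  obtain k l u where cf: "column_form P k l u" using baxter_column_form[OF H(1)] by blast
  \<comment> \<open>The enlarged slicing is only known to have some derivation;
    \<open>baxter_unique\<close> below identifies its horizontal blocks with the expected ones, the
    new row among them.\<close>
  obtain m H' where H': "baxter m (P \<union> new_row P w) (insert (new_row P w) D) H'"
    "\<forall>u\<in>H'. width u \<le> r_stat (P \<union> new_row P w) u + 1"
    using ex by (auto simp: all_schroeder_slicings_def add_block_def schroeder_slicings_iff)
  obtain k' l' u' where "column_form (P \<union> new_row P w) k' l' u'"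
    using baxter_column_form[OF H'(1)] by blast
  then have w': "w \<le> width (top_row P)" by (rule add_row_bound[OF cf _ w])
  have "H' = insert (new_row P w) H"
    using baxter_unique[OF H'(1) baxter_add_row[OF H(1) w(1) w']] .
  then have "w \<le> r_stat P (right_column P) + 1"
    using H'(2) width_new_row[OF cf w(1) w'] r_stat_new_row[OF cf w(1) w'] by simp
  then show ?thesis using w' by (simp add: max_row_def)
qed

lemma max_row_le_width: "(P, D) \<in> schroeder_slicings n \<Longrightarrow> 0 < max_row P \<and> max_row P \<le> width P"
  using baxter_column_form width_top_row_pos
  by (fastforce simp: schroeder_slicings_iff max_row_def min_def)

text \<open>The admissible widths form the whole interval from 1 to \<open>max_row P\<close>, so
  \<open>max_row P\<close> is the maximum taken in \<open>slicing_label\<close>.\<close>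

lemma addable_rows:
  assumes S: "(P, D) \<in> schroeder_slicings n"
  shows "u \<in> new_rows P \<and> add_block u (P, D) \<in> all_schroeder_slicings \<longleftrightarrow>
    u \<in> new_row P ` {1..max_row P}"
proof
  assume "u \<in> new_rows P \<and> add_block u (P, D) \<in> all_schroeder_slicings"
  then show "u \<in> new_row P ` {1..max_row P}"
    using add_row_max_row[OF S] by (auto simp: new_rows_eq)
next
  assume "u \<in> new_row P ` {1..max_row P}"
  then obtain w where w: "u = new_row P w" "0 < w" "w \<le> max_row P" by auto
  then show "u \<in> new_rows P \<and> add_block u (P, D) \<in> all_schroeder_slicings"
    using schroeder_add_row[OF S w(2,3)] max_row_le_width[OF S]
    by (auto simp: new_rows_eq all_schroeder_slicings_def)
qed

lemma slicing_children_eq: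
  assumes S: "(P, D) \<in> schroeder_slicings n"
  shows "slicing_children (P, D) =
    (\<lambda>u. add_block u (P, D)) ` (new_row P ` {1..max_row P} \<union> new_column P ` {1..height (right_column P)})"
    (is "_ = ?f ` ?U")
proof -
  have "u \<in> new_rows P \<and> ?f u \<in> all_schroeder_slicings \<longleftrightarrow> u \<in> new_row P ` {1..max_row P}" for u
    by (rule addable_rows[OF S])
  moreover have "?f u \<in> all_schroeder_slicings" if u: "u \<in> new_columns P" for u
  proof -
    obtain j where "u = new_column P j" "0 < j" "j \<le> height (right_column P)"
      using u by (auto simp: new_columns_eq)
    then show ?thesis
      using schroeder_add_column[OF S] by (auto simp: all_schroeder_slicings_def)
  qed
  ultimately have "{u. u \<in> new_rows P \<union> new_columns P \<and> ?f u \<in> all_schroeder_slicings} = ?U"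
    unfolding new_columns_eq by blast
  moreover have "slicing_children (P, D) =
      ?f ` {u. u \<in> new_rows P \<union> new_columns P \<and> ?f u \<in> all_schroeder_slicings}"
    unfolding slicing_children_def by auto
  ultimately show ?thesis by simp
qed

text \<open>The new top row has width \<open>w \<le> r + 1\<close>, and \<open>r\<close> at the
  right end does not change, so the minimum in \<open>max_row\<close> becomes
  \<open>w\<close>.\<close>

lemma new_row_valid:
  assumes S: "(P, D) \<in> schroeder_slicings n" and w: "0 < w" "w \<le> max_row P"
  obtains k l u where "column_form P k l u" "w \<le> width (top_row P)" "max_row (P \<union> new_row P w) = w"
    "height (right_column (P \<union> new_row P w)) = Suc (height (right_column P))"
    "width (new_row P w) = w"
proof -
  obtain H where H: "baxter n P D H"
    using S by (auto simp: schroeder_slicings_iff)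
  obtain k l u where cf: "column_form P k l u" using baxter_column_form[OF H(1)] by blast
  have w': "w \<le> width (top_row P)" using w by (simp add: max_row_def)
  have "max_row (P \<union> new_row P w) = w"
    using w(2) unfolding max_row_def top_row_add_row[OF cf w(1) w']
      r_stat_right_column_add_row[OF cf w(1) w'] width_new_row[OF cf w(1) w'] by simp
  then show thesis
    using that[OF cf w'] height_right_column_add_row[OF cf w(1) w'] width_new_row[OF cf w(1) w']
    by simp
qed

text \<open>A column of full height raises both terms of the minimum in \<open>max_row\<close> by 1.
  A shorter one resets \<open>r\<close> to 1 while the top row has width at least 2, so the minimum
  is 2.\<close>

lemma new_column_label:
  assumes S: "(P, D) \<in> schroeder_slicings n" and j: "0 < j" "j \<le> height (right_column P)"
  shows "height (right_column (P \<union> new_column P j)) = j"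
    and "max_row (P \<union> new_column P j) = (if j = height (right_column P) then Suc (max_row P) else 2)"
proof -
  obtain H where H: "baxter n P D H"
    using S by (auto simp: schroeder_slicings_iff)
  obtain k l u where cf: "column_form P k l u" using baxter_column_form[OF H(1)] by blast
  show "height (right_column (P \<union> new_column P j)) = j"
    unfolding right_column_add_column[OF cf j] by (rule height_new_column[OF cf j])
  show "max_row (P \<union> new_column P j) = (if j = height (right_column P) then Suc (max_row P) else 2)"
    using width_top_row_pos[OF cf]
    unfolding max_row_def width_top_row_add_column[OF cf j] r_stat_right_column_add_column[OF cf j]
    by auto
qed

lemma slicing_label_eq:
  assumes S: "(P, D) \<in> schroeder_slicings n"
  shows "slicing_label (P, D) = (max_row P, height (right_column P))"
proof -
  have "{width u | u. u \<in> new_rows P \<and> add_block u (P, D) \<in> all_schroeder_slicings} =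
      width ` new_row P ` {1..max_row P}"
    using addable_rows[OF S] by blast
  also have "\<dots> = id ` {1..max_row P}"
    unfolding image_image
  proof (rule image_cong[OF refl])
    fix w assume "w \<in> {1..max_row P}"
    then have "0 < w" "w \<le> max_row P" by auto
    then show "width (new_row P w) = id w"
      by (rule new_row_valid[OF S]) simp
  qed
  finally show ?thesis
    using max_row_le_width[OF S] Max_eqI[of "{1..max_row P}" "max_row P"]
    by (simp add: slicing_label_def Suc_le_eq)
qed

lemma slicing_child_block:
  assumes S: "(P, D) \<in> schroeder_slicings n"
    and u: "u \<in> new_row P ` {1..max_row P} \<union> new_column P ` {1..height (right_column P)}"
  shows "P \<inter> u = {}" "(width (P \<union> u) - 1, height (P \<union> u) - 1) \<in> u"
proof -
  obtain H where H: "baxter n P D H"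
    using S by (auto simp: schroeder_slicings_iff)
  obtain k l v where cf: "column_form P k l v" using baxter_column_form[OF H(1)] by blast
  show "P \<inter> u = {}"
    using u row_disjoint[OF cf] column_disjoint[OF cf] by auto
  from u consider w where "u = new_row P w" "0 < w" "w \<le> width (top_row P)" |
     j where "u = new_column P j" "0 < j" "j \<le> height (right_column P)"
    by (force simp: max_row_def)
  then show "(width (P \<union> u) - 1, height (P \<union> u) - 1) \<in> u"
  proof cases
    case 1
    then show ?thesis
      using corner_mem(1)[OF column_form_add_row[OF cf 1(2,3)]] top_row_add_row[OF cf 1(2,3)] by simp
  next
    case 2
    then show ?thesis
      using corner_mem(2)[OF column_form_add_column[OF cf 2(2,3)]]
        right_column_add_column[OF cf 2(2,3)] by simp
  qed
qed

lemma schroeder_blocks: "(P, D) \<in> schroeder_slicings n \<Longrightarrow> B \<in> D \<Longrightarrow> B \<subseteq> P \<and> B \<noteq> {}"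
  unfolding schroeder_slicings_iff by (blast dest: baxter_blocks)

text \<open>The child has only one block through its top right corner, hence \<open>u = u'\<close>.
  Removing this block, which is disjoint from both parents, gives the parents back.\<close>

lemma add_block_eqD:
  assumes S: "(P, D) \<in> schroeder_slicings n"
    and u: "u \<in> new_row P ` {1..max_row P} \<union> new_column P ` {1..height (right_column P)}"
    and S': "(P', D') \<in> schroeder_slicings n'"
    and u': "u' \<in> new_row P' ` {1..max_row P'} \<union> new_column P' ` {1..height (right_column P')}"
    and eq: "add_block u (P, D) = add_block u' (P', D')"
  shows "u = u' \<and> P = P' \<and> D = D'"
proof -
  note b = slicing_child_block[OF S u] and b' = slicing_child_block[OF S' u']
  have eqs: "P \<union> u = P' \<union> u'" "insert u D = insert u' D'"
    using eq by (auto simp: add_block_def)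
  have "B \<subseteq> P \<and> B \<noteq> {}" if "B \<in> D" for B
    by (rule schroeder_blocks[OF S that])
  moreover have "P = P \<union> u - u" "P' = P \<union> u - u'" using b(1) b'(1) eqs(1) by auto
  moreover have "B \<subseteq> P' \<and> B \<noteq> {}" if "B \<in> D'" for B
    by (rule schroeder_blocks[OF S' that])
  ultimately have "u = u' \<and> D = D'"
    using insert_block_eq[OF eqs(2) b(2), of "P \<union> u"] b'(2) eqs(1) by metis
  then show ?thesis using b(1) b'(1) eqs(1) by auto
qed

section \<open>Levels of the tree by size\<close>

lemma schroeder_slicings_Suc_0: "schroeder_slicings (Suc 0) = {root_slicing}"
proof -
  have "baxter (Suc 0) P D H \<longleftrightarrow> P = {(0, 0)} \<and> D = {{(0, 0)}} \<and> H = {}" for P D H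
  proof
    assume "baxter (Suc 0) P D H"
    then show "P = {(0, 0)} \<and> D = {{(0, 0)}} \<and> H = {}"
      by cases (use psize_1 baxter_polyomino in fastforce)+
  next
    have "parallelogram_polyomino {(0, 0)}" "psize {(0, 0)} = 1"
      using single_cell_column_form column_form_size(5)[OF single_cell_column_form]
      by (auto simp: parallelogram_polyomino_iff)
    then have "baxter 1 {(0, 0)} {{(0, 0)}} {}" by (rule baxter.single)
    moreover assume "P = {(0, 0)} \<and> D = {{(0, 0)}} \<and> H = {}"
    ultimately show "baxter (Suc 0) P D H" by simp
  qed
  then show ?thesis
    by (auto simp: schroeder_slicings_iff root_slicing_def)
qed

lemma schroeder_slicings_0: "schroeder_slicings 0 = {}"
  using baxter_polyomino by (fastforce simp: schroeder_slicings_iff)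

text \<open>Removing the last block inverts the growth, and the remaining horizontal blocks keep
  their value of \<open>r\<close>, so the Schroeder condition passes to the parent.\<close>

lemma schroeder_slicings_Suc:
  assumes "0 < n"
  shows "schroeder_slicings (Suc n) = (\<Union>S\<in>schroeder_slicings n. slicing_children S)"
proof
  show "(\<Union>S\<in>schroeder_slicings n. slicing_children S) \<subseteq> schroeder_slicings (Suc n)"
  proof clarify
    fix P D P' D' assume S: "(P, D) \<in> schroeder_slicings n" and "(P', D') \<in> slicing_children (P, D)"
    then show "(P', D') \<in> schroeder_slicings (Suc n)"
      unfolding slicing_children_eq[OF S] using schroeder_add_row[OF S] schroeder_add_column[OF S]
      by force
  qed
  show "schroeder_slicings (Suc n) \<subseteq> (\<Union>S\<in>schroeder_slicings n. slicing_children S)"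
  proof clarify
    fix P D assume "(P, D) \<in> schroeder_slicings (Suc n)"
    then obtain H where H: "baxter (Suc n) P D H" "\<forall>u\<in>H. width u \<le> r_stat P u + 1"
      and all: "(P, D) \<in> all_schroeder_slicings"
      by (auto simp: schroeder_slicings_iff all_schroeder_slicings_def)
    obtain k l u where cf: "column_form P k l u" using baxter_column_form[OF H(1)] by blast
    \<comment> \<open>Common to both kinds of last block \<open>b\<close>: the inclusion
      \<open>H' \<subseteq> H\<close> allows \<open>b\<close> to be horizontal or vertical.\<close>
    have child: "\<exists>S\<in>schroeder_slicings n. (P, D) \<in> slicing_children S"
      if D: "D = insert b D'" and b: "b \<subseteq> P" "b \<in> new_rows (P - b) \<union> new_columns (P - b)"
        and H': "baxter n (P - b) D' H'" "H' \<subseteq> H"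
        and r: "\<And>B. B \<in> H' \<Longrightarrow> r_stat P B = r_stat (P - b) B" for b D' H'
    proof
      have "\<forall>B\<in>H'. width B \<le> r_stat (P - b) B + 1"
        using H(2) H'(2) r by fastforce
      then show "(P - b, D') \<in> schroeder_slicings n"
        using H'(1) by (auto simp: schroeder_slicings_iff)
      have "(P, D) = add_block b (P - b, D')"
        using b(1) D by (auto simp: add_block_def)
      then show "(P, D) \<in> slicing_children (P - b, D')"
        using b(2) all unfolding slicing_children_def by auto
    qed
    have r: "r_stat P B = r_stat (P - b) B"
      if H': "baxter n (P - b) D' H'" "B \<in> H'"
        and b: "b \<subseteq> P" "b \<in> new_rows (P - b) \<union> new_columns (P - b)"
      for b D' H' B
    proof -
      obtain k' l' u' where cf': "column_form (P - b) k' l' u'"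
        using baxter_column_form[OF H'(1)] by blast
      have P: "P = (P - b) \<union> b" using b(1) by auto
      have B: "Max (fst ` B) < k'"
        using baxter_blocks[OF H'(1)] H'(2) by (intro Max_fst_less_width[OF cf']) auto
      from b(2) consider w where "b = new_row (P - b) w" "0 < w" "w \<le> width (P - b)" |
        j where "b = new_column (P - b) j" "0 < j" "j \<le> height (right_column (P - b))"
        by (auto simp: new_rows_eq new_columns_eq)
      then show ?thesis
      proof cases
        case 1
        \<comment> \<open>The bound holds because adding the row back gives \<open>P\<close>, which
          is a polyomino.\<close>
        then have "w \<le> width (top_row (P - b))"
          using add_row_bound[OF cf' _ 1(2,3)] cf P by metis
        from r_stat_add_row[OF cf' 1(2) this B] show ?thesis using P 1(1) by metis
      next
        case 2
        from r_stat_add_column[OF cf' 2(2,3) B] show ?thesis using P 2(1) by metis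
      qed
    qed
    from H(1) have "\<exists>S\<in>schroeder_slicings n. (P, D) \<in> slicing_children S"
    proof cases
      case single
      then show ?thesis using assms by simp
    next
      case (horizontal D' H')
      obtain k' l' u' where cf': "column_form (P - top_row P) k' l' u'"
        using baxter_column_form[OF horizontal(5)] by blast
      have b: "top_row P \<in> new_rows (P - top_row P)"
        using top_row_in_new_rows[OF cf cf'] horizontal(4) baxter_polyomino[OF horizontal(5)] by simp
      have sub: "top_row P \<subseteq> P" by (auto simp: top_row_def)
      show ?thesis
        by (rule child[OF horizontal(1) sub _ horizontal(5)])
          (use b sub horizontal(2) r[OF horizontal(5)] in auto)
    next
      case (vertical D')
      obtain k' l' u' where cf': "column_form (P - right_column P) k' l' u'"
        using baxter_column_form[OF vertical(4)] by blast
      have b: "right_column P \<in> new_columns (P - right_column P)"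
        using right_column_in_new_columns[OF cf cf'] vertical(3) baxter_polyomino[OF vertical(4)]
        by simp
      have sub: "right_column P \<subseteq> P" by (auto simp: right_column_def)
      show ?thesis
        by (rule child[OF vertical(1) sub _ vertical(4)])
          (use b sub r[OF vertical(4)] in auto)
    qed
    then show "(P, D) \<in> (\<Union>S\<in>schroeder_slicings n. slicing_children S)" by blast
  qed
qed

lemma slicing_children_disjoint:
  assumes S: "S \<in> schroeder_slicings n" "S' \<in> schroeder_slicings n'"
    and T: "T \<in> slicing_children S" "T \<in> slicing_children S'"
  shows "S = S'"
proof -
  obtain P D where PD: "S = (P, D)" by (cases S)
  obtain P' D' where PD': "S' = (P', D')" by (cases S')
  note S1 = S(1)[unfolded PD] and S2 = S(2)[unfolded PD']
  obtain u where u: "u \<in> new_row P ` {1..max_row P} \<union> new_column P ` {1..height (right_column P)}"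
    "T = add_block u (P, D)"
    using T(1) unfolding PD slicing_children_eq[OF S1] by blast
  obtain u' where u': "u' \<in> new_row P' ` {1..max_row P'} \<union> new_column P' ` {1..height (right_column P')}"
    "T = add_block u' (P', D')"
    using T(2) unfolding PD' slicing_children_eq[OF S2] by blast
  have "u = u' \<and> P = P' \<and> D = D'"
    using u(2) u'(2) by (intro add_block_eqD[OF S1 u(1) S2 u'(1)]) simp
  then show ?thesis by (simp add: PD PD')
qed

lemma slicing_label_pos:
  assumes "S \<in> schroeder_slicings n" "slicing_label S = (h, k)"
  shows "0 < h" "0 < k"
proof -
  obtain P D where PD: "S = (P, D)" by (cases S)
  note S' = assms(1)[unfolded PD]
  have hk': "h = max_row P" "k = height (right_column P)"
    using assms(2) slicing_label_eq[OF S'] by (simp_all add: PD)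
  show "0 < h" using hk' max_row_le_width[OF S'] by simp
  obtain H where "baxter n P D H"
    using S' by (auto simp: schroeder_slicings_iff)
  then obtain m l u where cf: "column_form P m l u" using baxter_column_form by blast
  show "0 < k"
    using column_formD(1)[OF cf] column_formD(8)[OF cf, of "m - 1"]
    by (simp add: hk' right_column_form(2)[OF cf])
qed

lemma label_children:
  assumes S: "S \<in> schroeder_slicings n" and hk: "slicing_label S = (h, k)"
  shows "finite (slicing_children S) \<and>
    image_mset slicing_label (mset_set (slicing_children S)) = mset (NewSch (h, k))"
proof -
  obtain P D where PD: "S = (P, D)" by (cases S)
  note S' = S[unfolded PD]
  have hk': "h = max_row P" "k = height (right_column P)"
    using hk slicing_label_eq[OF S'] by (simp_all add: PD)
  have k: "0 < k" by (rule slicing_label_pos[OF S hk])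
  define f where "f = (\<lambda>w. add_block (new_row P w) (P, D))"
  define g where "g = (\<lambda>j. add_block (new_column P j) (P, D))"
  have lf: "slicing_label (f w) = (w, k + 1)" if "w \<in> {1..h}" for w
  proof -
    have w: "0 < w" "w \<le> max_row P" using that hk' by auto
    show ?thesis
      by (rule new_row_valid[OF S' w])
        (use slicing_label_eq schroeder_add_row[OF S' w] in \<open>simp add: f_def add_block_def hk'\<close>)
  qed
  have lg: "slicing_label (g j) = (if j = k then Suc h else 2, j)" if "j \<in> {1..k}" for j
  proof -
    have j: "0 < j" "j \<le> height (right_column P)" using that hk' by auto
    show ?thesis
      using new_column_label[OF S' j] slicing_label_eq schroeder_add_column[OF S' j]
      by (simp add: g_def add_block_def hk')
  qed
  \<comment> \<open>A row child shows its width in the first label entry, a column child its height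
    in the second. Rows and columns are told apart by the second entry, which is
    \<open>k + 1\<close> for a row and at most \<open>k\<close> for a column.\<close>
  have inj: "inj_on f {1..h}" "inj_on g {1..k}"
    by (rule inj_onI, metis lf prod.inject) (rule inj_onI, metis lg prod.inject)
  have disj: "f ` {1..h} \<inter> g ` {1..k} = {}"
  proof -
    have "f w \<noteq> g j" if "w \<in> {1..h}" "j \<in> {1..k}" for w j
      using lf[OF that(1)] lg[OF that(2)] that(2) by auto
    then show ?thesis by blast
  qed
  have ch: "slicing_children S = f ` {1..h} \<union> g ` {1..k}"
    unfolding PD slicing_children_eq[OF S'] hk' f_def g_def by blast
  have "image_mset slicing_label (mset_set (slicing_children S)) =
      image_mset slicing_label (image_mset f (mset_set {1..h})) +
      image_mset slicing_label (image_mset g (mset_set {1..k}))"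
    unfolding ch using disj inj by (simp add: mset_set_Union image_mset_mset_set)
  also have "image_mset slicing_label (image_mset f (mset_set {1..h})) =
      image_mset (\<lambda>w. (w, k + 1)) (mset_set {1..h})"
    unfolding multiset.map_comp by (rule image_mset_cong) (use lf in simp)
  also have "image_mset slicing_label (image_mset g (mset_set {1..k})) =
      image_mset (\<lambda>j. (if j = k then Suc h else 2, j)) (mset_set {1..k})"
    unfolding multiset.map_comp by (rule image_mset_cong) (use lg in simp)
  \<comment> \<open>The column of full height is split off: it alone yields
    \<open>(h + 1, k)\<close>.\<close>
  also have "{1..k} = insert k {1..<k}" using k by auto
  also have "image_mset (\<lambda>j. (if j = k then Suc h else 2, j)) (mset_set (insert k {1..<k})) =
      add_mset (Suc h, k) (image_mset (\<lambda>j. (if j = k then Suc h else 2, j)) (mset_set {1..<k}))"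
    by simp
  also have "image_mset (\<lambda>j. (if j = k then Suc h else 2, j)) (mset_set {1..<k}) =
      image_mset (\<lambda>j. (2, j)) (mset_set {1..<k})"
    by (rule image_mset_cong) simp
  also have "{1..h} = {1..<h + 1}" by auto
  finally show ?thesis by (simp add: ch del: upt_Suc)
qed

subsection \<open>Enumeration\<close>

text \<open>\<open>descendants m s\<close> counts the nodes \<open>m\<close> levels below a node with label \<open>(h, k)\<close>, \<open>h + k = s\<close>.\<close>

fun descendants :: "nat \<Rightarrow> nat \<Rightarrow> nat" where
  "descendants 0 s = 1"
| "descendants (Suc m) s = (\<Sum>t = 3..s + 1. descendants m t) + descendants m (s + 1)"

text \<open>The label sums of the children are \<open>k + 2..h + k + 1\<close> from the rows,
  \<open>3..k + 1\<close> from the shorter columns and once more \<open>h + k + 1\<close> from the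
  full column. The two ranges are adjacent, so the result depends on \<open>h + k\<close>
  only.\<close>

lemma sum_NewSch:
  assumes "0 < h" "0 < k"
  shows "(\<Sum>l\<in>#mset (NewSch (h, k)). descendants m (fst l + snd l)) = descendants (Suc m) (h + k)"
proof -
  let ?d = "descendants m"
  have "(\<Sum>l\<in>#mset (NewSch (h, k)). ?d (fst l + snd l)) =
      (\<Sum>i = 1..<h + 1. ?d (i + (k + 1))) + (\<Sum>j = 1..<k. ?d (2 + j)) + ?d (h + 1 + k)"
    by (simp add: multiset.map_comp comp_def sum_unfold_sum_mset del: upt_Suc)
  also have "(\<Sum>i = 1..<h + 1. ?d (i + (k + 1))) = (\<Sum>t = k + 2..<h + k + 2. ?d t)"
    using sum.shift_bounds_nat_ivl[of ?d 1 "k + 1" "h + 1"] by (simp add: algebra_simps)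
  also have "(\<Sum>j = 1..<k. ?d (2 + j)) = (\<Sum>t = 3..<k + 2. ?d t)"
  proof -
    have "1 + 2 = (3 :: nat)" by simp
    then show ?thesis
      using sum.shift_bounds_nat_ivl[of ?d 1 2 k] by (simp only: add.commute)
  qed
  also have "(\<Sum>t = k + 2..<h + k + 2. ?d t) + (\<Sum>t = 3..<k + 2. ?d t) = (\<Sum>t = 3..<h + k + 2. ?d t)"
    using sum.atLeastLessThan_concat[of 3 "k + 2" "h + k + 2" ?d] assms by simp
  also have "{3..<h + k + 2} = {3..h + k + 1}" by auto
  finally show ?thesis by (simp add: algebra_simps)
qed

lemma root_label: "slicing_label root_slicing = (1, 1)"
proof -
  have "root_slicing \<in> schroeder_slicings (Suc 0)" by (simp add: schroeder_slicings_Suc_0)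
  then have S: "({(0, 0)}, {{(0, 0)}}) \<in> schroeder_slicings (Suc 0)" by (simp add: root_slicing_def)
  note cf = single_cell_column_form
  have "width (top_row {(0, 0)}) = 1"
    using width_top_row_pos[OF cf] by (simp add: column_form_size(3)[OF cf])
  then show ?thesis
    unfolding root_slicing_def slicing_label_eq[OF S] by (simp add: max_row_def right_column_form(2)[OF cf])
qed

text \<open>Weighting the slicings of size \<open>n + 1\<close> by their descendants
  \<open>m\<close> levels below counts those of size \<open>n + m + 1\<close>; the induction trades
  a level of \<open>m\<close> for one of \<open>n\<close>. The argument 2 is the sum of the root
  label. For \<open>m = 0\<close> the weighted sum is the cardinality.\<close>

lemma descendants_sum:
  "finite (schroeder_slicings (Suc n)) \<and>
   (\<Sum>S\<in>schroeder_slicings (Suc n). descendants m (fst (slicing_label S) + snd (slicing_label S))) =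
     descendants (n + m) 2"
proof (induction n arbitrary: m)
  case 0
  then show ?case by (simp add: schroeder_slicings_Suc_0 root_label numeral_2_eq_2)
next
  case (Suc n)
  let ?A = "schroeder_slicings (Suc n)"
  let ?w = "\<lambda>m S. descendants m (fst (slicing_label S) + snd (slicing_label S))"
  have fin: "finite ?A" using Suc by blast
  have ch: "finite (slicing_children S)" "(\<Sum>T\<in>slicing_children S. ?w m T) = ?w (Suc m) S"
    if "S \<in> ?A" for S
  proof -
    obtain h k where hk: "slicing_label S = (h, k)" by (cases "slicing_label S")
    note l = label_children[OF that hk]
    show "finite (slicing_children S)" using l by simp
    have "(\<Sum>T\<in>slicing_children S. ?w m T) =
        (\<Sum>l\<in>#image_mset slicing_label (mset_set (slicing_children S)). descendants m (fst l + snd l))"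
      by (simp only: sum_unfold_sum_mset multiset.map_comp comp_def)
    also have "\<dots> = descendants (Suc m) (h + k)"
      using l sum_NewSch[OF slicing_label_pos[OF that hk]] by simp
    finally show "(\<Sum>T\<in>slicing_children S. ?w m T) = ?w (Suc m) S"
      by (simp add: hk)
  qed
  have eq: "schroeder_slicings (Suc (Suc n)) = (\<Union>S\<in>?A. slicing_children S)"
    by (rule schroeder_slicings_Suc) simp
  have "(\<Sum>T\<in>schroeder_slicings (Suc (Suc n)). ?w m T) = (\<Sum>S\<in>?A. \<Sum>T\<in>slicing_children S. ?w m T)"
    unfolding eq
  proof (intro sum.UNION_disjoint ballI impI)
    fix S S' assume S: "S \<in> ?A" "S' \<in> ?A" "S \<noteq> S'"
    then show "slicing_children S \<inter> slicing_children S' = {}"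
      using slicing_children_disjoint[OF S(1,2)] by blast
  qed (use fin ch(1) in auto)
  also have "\<dots> = (\<Sum>S\<in>?A. ?w (Suc m) S)"
    by (rule sum.cong) (use ch(2) in simp_all)
  also have "\<dots> = descendants (n + Suc m) 2" using Suc by blast
  finally show ?case using fin ch(1) by (simp add: eq)
qed

section \<open>The generating function\<close>

lemma schroeder_gf_eq: "schroeder_gf = 1 + fps_X * schroeder_gf + fps_X * schroeder_gf ^ 2"
proof -
  define R :: "real fps" where "R = fps_radical root 2 (1 - 6 * fps_X + fps_X ^ 2)"
  define N where "N = 1 - fps_X - R"
  let ?A = "1 - 6 * fps_X + fps_X ^ 2 :: real fps"
  have A0: "fps_nth ?A 0 = 1" by (simp add: fps_nth_power_0)
  have R0: "fps_nth R 0 = 1" by (simp add: R_def fps_nth_power_0)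
  have "R ^ Suc 1 = ?A"
    unfolding R_def numeral_2_eq_2 One_nat_def[symmetric]
    using power_radical[of ?A root 1] A0 by (simp add: numeral_2_eq_2)
  then have R2: "R ^ 2 = ?A" by (simp add: numeral_2_eq_2)
  \<comment> \<open>The constant term of \<open>N\<close> is 0, so the division by
    \<open>2 * fps_X\<close> in \<open>schroeder_gf\<close> is exact and amounts to a shift.\<close>
  define G where "G = fps_const (1 / 2) * fps_shift 1 N"
  have "fps_nth N 0 = 0" by (simp add: N_def R0)
  then have "fps_X * fps_shift 1 N = N"
    by (intro fps_ext) (auto simp: fps_X_mult_nth)
  moreover have "2 * fps_const (1 / 2) = (1 :: real fps)"
    by (simp add: numeral_fps_const)
  ultimately have N: "N = 2 * fps_X * G"
    unfolding G_def by (metis mult.assoc mult.commute mult.left_neutral)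
  then have "schroeder_gf = G"
    unfolding schroeder_gf_def R_def[symmetric] N_def[symmetric] by simp
  have "R = 1 - fps_X - 2 * fps_X * G" using N unfolding N_def by (simp add: algebra_simps)
  \<comment> \<open>Squaring removes the root, and cancelling \<open>4 * fps_X\<close> leaves the
    quadratic equation.\<close>
  then have "(1 - fps_X - 2 * fps_X * G) ^ 2 = ?A" using R2 by simp
  then have "4 * fps_X * (1 + fps_X * G + fps_X * G ^ 2 - G) = 0"
    by (simp add: power2_eq_square algebra_simps)
  then have "1 + fps_X * G + fps_X * G ^ 2 - G = 0" by simp
  then show ?thesis unfolding \<open>schroeder_gf = G\<close> by simp
qed

lemma descendants_gf:
  fixes Z :: "real fps"
  defines "Z \<equiv> fps_const (1 / 2) * (1 + schroeder_gf)"
  shows "fps_nth (schroeder_gf * Z ^ a) m = real (descendants m (a + 2))"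
proof -
  define G where "G = schroeder_gf"
  define F where "F = (\<lambda>s. G * Z ^ (s - 2))"
  have G: "G = 1 + fps_X * G + fps_X * G ^ 2"
    unfolding G_def by (rule schroeder_gf_eq)
  have half: "2 * fps_const (1 / 2) = (1 :: real fps)"
    by (simp add: numeral_fps_const)
  have Z2: "2 * Z = 1 + G"
    unfolding Z_def G_def[symmetric] mult.assoc[symmetric] half by simp
  have "2 * (Z - 1) = 2 * (fps_X * G * Z)"
  proof -
    have "2 * (Z - 1) = G - 1" using Z2 by (simp add: algebra_simps)
    also have "\<dots> = fps_X * G * (1 + G)"
      by (subst (1) G) (simp add: algebra_simps power2_eq_square)
    also have "\<dots> = 2 * (fps_X * G * Z)" unfolding Z2[symmetric] by (simp add: algebra_simps)
    finally show ?thesis .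
  qed
  then have "Z - 1 = fps_X * G * Z"
    by (subst (asm) mult_left_cancel) simp_all
  then have Z1: "Z = 1 + fps_X * G * Z" by (simp add: algebra_simps)
  \<comment> \<open>From \<open>a\<close> to \<open>a + 1\<close> the right side grows by
    \<open>fps_X * (2 * F (a + 4) - F (a + 3))\<close>. The left side grows by
    \<open>G * Z ^ a * (Z - 1)\<close>, which is the same because the equation of \<open>G\<close>
    reads \<open>Z - 1 = fps_X * (Z * (2 * Z - 1))\<close> in terms of \<open>Z\<close>.\<close>
  have F: "F (a + 2) = 1 + fps_X * ((\<Sum>t = 3..a + 3. F t) + F (a + 3))" for a
  proof (induction a)
    case 0
    have "1 + fps_X * (F 3 + F 3) = 1 + fps_X * (G * (2 * Z))"
      by (simp add: F_def algebra_simps)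
    also have "\<dots> = G" unfolding Z2 by (subst (3) G) (simp add: algebra_simps power2_eq_square)
    finally show ?case by (simp add: F_def)
  next
    case (Suc a)
    have "F (a + 3) = F (a + 2) + G * Z ^ a * (Z - 1)"
      by (simp add: F_def algebra_simps numeral_3_eq_3)
    also have "Z - 1 = fps_X * (Z * (2 * Z - 1))"
      using Z1 Z2 by (simp add: algebra_simps)
    also have "G * Z ^ a * (fps_X * (Z * (2 * Z - 1))) = fps_X * (2 * F (a + 4) - F (a + 3))"
      by (simp add: F_def algebra_simps eval_nat_numeral)
    also have "F (a + 2) + fps_X * (2 * F (a + 4) - F (a + 3)) =
        1 + fps_X * ((\<Sum>t = 3..a + 3. F t) + F (a + 4) + F (a + 4))"
      unfolding Suc by (simp add: algebra_simps)
    also have "(\<Sum>t = 3..a + 3. F t) + F (a + 4) = (\<Sum>t = 3..Suc a + 3. F t)"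
      by (simp add: eval_nat_numeral)
    finally show ?case by (simp add: eval_nat_numeral)
  qed
  \<comment> \<open>The factor \<open>fps_X\<close> in the recurrence expresses coefficient
    \<open>Suc m\<close> through coefficients of index \<open>m\<close> of other members of the
    family, hence the induction on \<open>m\<close> for all \<open>a\<close> at once.\<close>
  have "fps_nth (F (a + 2)) m = real (descendants m (a + 2))" for a
  proof (induction m arbitrary: a)
    case 0
    show ?case by (subst F) simp
  next
    case (Suc m)
    have IH: "fps_nth (F t) m = real (descendants m t)" if "2 \<le> t" for t
      using Suc[of "t - 2"] that by (simp del: add_2_eq_Suc')
    have "fps_nth (F (a + 2)) (Suc m) = (\<Sum>t = 3..a + 3. fps_nth (F t) m) + fps_nth (F (a + 3)) m"
      by (subst F) (simp add: fps_X_mult_nth fps_sum_nth)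
    also have "(\<Sum>t = 3..a + 3. fps_nth (F t) m) = (\<Sum>t = 3..a + 3. real (descendants m t))"
      by (rule sum.cong) (use IH in auto)
    finally show ?case by (simp add: IH eval_nat_numeral)
  qed
  then show ?thesis by (simp add: F_def G_def)
qed

lemma card_schroeder_slicings:
  assumes "1 \<le> n"
  shows "finite (schroeder_slicings n) \<and> real (card (schroeder_slicings n)) = large_schroeder n"
proof -
  obtain n' where n: "n = Suc n'" using assms by (cases n) auto
  \<comment> \<open>With \<open>m = 0\<close> every slicing has weight 1, and with exponent 0 the
    power of \<open>Z\<close> disappears and leaves \<open>schroeder_gf\<close>.\<close>
  show ?thesis
    using descendants_sum[of n' 0] descendants_gf[of 0 n'] by (simp add: n large_schroeder_def numeral_2_eq_2)
qed

subsection \<open>Generating trees\<close>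

primrec follow :: "'v \<Rightarrow> ('v \<Rightarrow> 'v list) \<Rightarrow> nat list \<Rightarrow> 'v" where
  "follow r enum [] = r"
| "follow r enum (i # p) = enum (follow r enum p) ! i"

text \<open>A rule lists labels in an order, whereas children form a set. Equality of multisets lets
  the children be arranged so that their labels come in exactly the order of the list.\<close>

lemma enumerate_children:
  assumes "finite A" "image_mset f (mset_set A) = mset ls"
  shows "\<exists>xs. distinct xs \<and> set xs = A \<and> map f xs = ls"
proof -
  obtain ys where ys: "set ys = A" "distinct ys" using finite_distinct_list[OF assms(1)] by blast
  have "mset ls = mset (map f ys)"
    using assms(2) ys mset_set_set[of ys] by simp
  moreover have "list_all2 (\<lambda>l x. f x = l) (map f ys) ys"
    by (simp add: list_all2_conv_all_nth)
  ultimately obtain xs where xs: "list_all2 (\<lambda>l x. f x = l) ls xs" "mset xs = mset ys"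
    using list_all2_reorder_left_invariance by blast
  have "map f xs = ls"
    using xs(1) by (auto simp: list_all2_conv_all_nth intro: nth_equalityI)
  then show ?thesis
    using xs(2) ys mset_eq_imp_distinct_iff mset_eq_setD by metis
qed

text \<open>Addresses are sent to nodes by following a chosen order of the children. Unique parents
  and a root without parent make this map injective; \<open>reachable\<close>, stated as an
  induction principle, makes it surjective. The isomorphism is its inverse.\<close>

lemma tree_iso_rule_tree:
  fixes T :: "('v, 'l) labelled_tree"
  assumes root: "root_node T \<in> nodes T" "label T (root_node T) = a"
    and children_nodes: "\<And>v. v \<in> nodes T \<Longrightarrow> children T v \<subseteq> nodes T"
    and labels: "\<And>v. v \<in> nodes T \<Longrightarrow> finite (children T v) \<and>
      image_mset (label T) (mset_set (children T v)) = mset (rule (label T v))"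
    and parent: "\<And>v v' w. v \<in> nodes T \<Longrightarrow> v' \<in> nodes T \<Longrightarrow>
      w \<in> children T v \<Longrightarrow> w \<in> children T v' \<Longrightarrow> v = v'"
    and root_not_child: "\<And>v. v \<in> nodes T \<Longrightarrow> root_node T \<notin> children T v"
    and reachable: "\<And>A. root_node T \<in> A \<Longrightarrow> (\<And>v. v \<in> A \<Longrightarrow> v \<in> nodes T \<Longrightarrow> children T v \<subseteq> A) \<Longrightarrow>
      nodes T \<subseteq> A"
  shows "tree_iso T (rule_tree a rule)"
proof -
  obtain enum where enum: "\<And>v. v \<in> nodes T \<Longrightarrow> distinct (enum v)"
    "\<And>v. v \<in> nodes T \<Longrightarrow> set (enum v) = children T v"
    "\<And>v. v \<in> nodes T \<Longrightarrow> map (label T) (enum v) = rule (label T v)"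
  proof -
    have "\<exists>xs. distinct xs \<and> set xs = children T v \<and> map (label T) xs = rule (label T v)"
      if "v \<in> nodes T" for v
      by (rule enumerate_children) (use labels[OF that] in auto)
    then show thesis using that by metis
  qed
  define g where "g = follow (root_node T) enum"
  let ?N = "rule_nodes a rule"
  have g_Nil: "g [] = root_node T" and g_Cons: "g (i # p) = enum (g p) ! i" for i p
    by (simp_all add: g_def)
  have len: "length (enum v) = length (rule (label T v))" if "v \<in> nodes T" for v
    using enum(3)[OF that] by (metis length_map)
  have g: "g p \<in> nodes T \<and> label T (g p) = node_label a rule p" if "p \<in> ?N" for p
    using that
  proof induction
    case 1
    then show ?case using root by (simp add: g_Nil)
  next
    case (2 p i)
    then have i: "i < length (enum (g p))" using len by simp
    then have "g (i # p) \<in> children T (g p)"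
      using enum(2) 2 by (metis g_Cons nth_mem)
    moreover have "label T (g (i # p)) = rule (label T (g p)) ! i"
      using enum(3) 2 i by (metis g_Cons nth_map)
    ultimately show ?case using children_nodes 2 by auto
  qed
  have g_child: "g (i # p) \<in> children T (g p) \<and> i < length (enum (g p))" if "i # p \<in> ?N" for i p
    using that
  proof cases
    case 2
    then show ?thesis using g[of p] len enum(2) g_Cons by (metis nth_mem)
  qed
  have tl_node: "p \<in> ?N" if "i # p \<in> ?N" for i p
    using that by cases
  \<comment> \<open>Nonempty addresses with equal images have equal parents, hence equal tails by
    induction, and distinctness of the enumeration gives equal heads. The empty address goes to the
    root, which is no child.\<close>
  have "p \<in> ?N \<Longrightarrow> q \<in> ?N \<Longrightarrow> g p = g q \<Longrightarrow> p = q" for p q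
  proof (induction p arbitrary: q rule: list.induct)
    case Nil
    then show ?case
      using g_child g tl_node root_not_child by (cases q) (auto simp: g_Nil, metis)
  next
    case (Cons i p)
    show ?case
    proof (cases q)
      case Nil
      then show ?thesis
        using g_child[OF Cons.prems(1)] g[OF tl_node[OF Cons.prems(1)]] root_not_child Cons.prems(3)
        by (auto simp: g_Nil)
    next
      case q: (Cons j q')
      have N: "p \<in> ?N" "q' \<in> ?N" using Cons.prems q tl_node by blast+
      have c: "g (i # p) \<in> children T (g p) \<and> i < length (enum (g p))"
        "g (j # q') \<in> children T (g q') \<and> j < length (enum (g q'))"
        using g_child Cons.prems q by blast+
      then have "g p = g q'" using parent g N Cons.prems(3) q by metis
      moreover from this have "p = q'" using Cons.IH N by blast
      moreover have "i = j"
        using c Cons.prems(3) q \<open>g p = g q'\<close> enum(1) g N(1) nth_eq_iff_index_eq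
        by (metis g_Cons)
      ultimately show ?thesis using q by simp
    qed
  qed
  then have inj: "inj_on g ?N" by (intro inj_onI)
  have img: "g ` {i # p | i. i < length (rule (node_label a rule p))} = children T (g p)"
    if "p \<in> ?N" for p
  proof -
    have "{i # p | i. i < length (rule (node_label a rule p))} =
        (\<lambda>i. i # p) ` {..<length (enum (g p))}"
      using g[OF that] len[of "g p"] by auto
    then have "g ` {i # p | i. i < length (rule (node_label a rule p))} =
        (!) (enum (g p)) ` {..<length (enum (g p))}"
      by (simp add: image_image g_Cons)
    also have "\<dots> = set (enum (g p))"
      unfolding set_conv_nth by blast
    also have "\<dots> = children T (g p)"
      by (rule enum(2)) (use g[OF that] in blast)
    finally show ?thesis .
  qed
  have children_N: "{i # p | i. i < length (rule (node_label a rule p))} \<subseteq> ?N" if "p \<in> ?N" for p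
    by (auto intro: rule_nodes.intros(2)[OF that])
  have "nodes T \<subseteq> g ` ?N"
  proof (rule reachable)
    show "root_node T \<in> g ` ?N"
      using g_Nil rule_nodes.intros(1) by (metis imageI)
    fix v assume "v \<in> g ` ?N"
    then obtain p where p: "p \<in> ?N" "v = g p" by blast
    show "children T v \<subseteq> g ` ?N"
      using image_mono[OF children_N[OF p(1)], of g] unfolding img[OF p(1)] p(2) .
  qed
  then have "g ` ?N = nodes T" using g by blast
  then have bij: "bij_betw g ?N (nodes T)" using inj by (simp add: bij_betw_def)
  define f where "f = inv_into ?N g"
  have f: "f (g p) = p" if "p \<in> ?N" for p
    unfolding f_def using inj that by simp
  show ?thesis
    unfolding tree_iso_def rule_tree_def labelled_tree.simps
  proof (intro exI[of _ f] conjI ballI)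
    show "bij_betw f (nodes T) ?N"
      unfolding f_def using bij by (rule bij_betw_inv_into)
    show "f (root_node T) = []"
      using f[OF rule_nodes.intros(1)] by (simp add: g_Nil)
    fix v assume "v \<in> nodes T"
    then obtain p where p: "p \<in> ?N" "v = g p" using \<open>g ` ?N = nodes T\<close> by blast
    have "f ` children T v = f ` g ` {i # p | i. i < length (rule (node_label a rule p))}"
      unfolding p(2) img[OF p(1)] ..
    also have "\<dots> = id ` {i # p | i. i < length (rule (node_label a rule p))}"
      unfolding image_image by (rule image_cong) (use f children_N[OF p(1)] in auto)
    finally show "f ` children T v = {i # f v | i. i < length (rule (node_label a rule (f v)))}"
      using f[OF p(1)] p(2) by simp
    show "node_label a rule (f v) = label T v"
      using f[OF p(1)] g[OF p(1)] p(2) by simp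
  qed
qed

section \<open>The tree of Schroeder slicings\<close>

lemma schroeder_children_subset: "S \<in> schroeder_slicings n \<Longrightarrow> slicing_children S \<subseteq> schroeder_slicings (Suc n)"
  using schroeder_slicings_0 schroeder_slicings_Suc by (cases n) auto

lemma schroeder_tree_iso: "tree_iso schroeder_tree T_Sch"
  unfolding T_Sch_def
proof (rule tree_iso_rule_tree; (unfold schroeder_tree_def labelled_tree.simps)?)
  have root: "root_slicing \<in> schroeder_slicings (Suc 0)" by (simp add: schroeder_slicings_Suc_0)
  show "root_slicing \<in> all_schroeder_slicings"
    using root unfolding all_schroeder_slicings_def by blast
  show "slicing_label root_slicing = (1, 1)" by (rule root_label)
  show "slicing_children S \<subseteq> all_schroeder_slicings" if "S \<in> all_schroeder_slicings" for S
    using that schroeder_children_subset unfolding all_schroeder_slicings_def by blast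
  show "finite (slicing_children S) \<and>
      image_mset slicing_label (mset_set (slicing_children S)) = mset (NewSch (slicing_label S))"
    if "S \<in> all_schroeder_slicings" for S
    using that label_children unfolding all_schroeder_slicings_def
    by (metis UN_iff surj_pair)
  show "S = S'" if "S \<in> all_schroeder_slicings" "S' \<in> all_schroeder_slicings"
    "T \<in> slicing_children S" "T \<in> slicing_children S'" for S S' T
    using that slicing_children_disjoint unfolding all_schroeder_slicings_def by blast
  show "root_slicing \<notin> slicing_children S" if S: "S \<in> all_schroeder_slicings" for S
  proof
    assume "root_slicing \<in> slicing_children S"
    moreover obtain n where n: "S \<in> schroeder_slicings n"
      using S unfolding all_schroeder_slicings_def by blast
    ultimately have "root_slicing \<in> schroeder_slicings (Suc n)"
      using schroeder_children_subset by blast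
    \<comment> \<open>The polyomino determines the size, which is 1 for the root; a parent of the
      root would have size 0.\<close>
    then have "Suc n = Suc 0"
      using root baxter_polyomino unfolding root_slicing_def schroeder_slicings_iff by metis
    then show False using n by (simp add: schroeder_slicings_0)
  qed
  show "all_schroeder_slicings \<subseteq> A"
    if "root_slicing \<in> A" "\<And>S. S \<in> A \<Longrightarrow> S \<in> all_schroeder_slicings \<Longrightarrow> slicing_children S \<subseteq> A" for A
  proof -
    have "schroeder_slicings (Suc n) \<subseteq> A" for n
    proof (induction n)
      case 0
      then show ?case using that(1) by (simp add: schroeder_slicings_Suc_0)
    next
      case (Suc n)
      then show ?case
        using schroeder_slicings_Suc[of "Suc n"] that(2) unfolding all_schroeder_slicings_def by blast
    qed
    then have "schroeder_slicings n \<subseteq> A" for n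
      by (cases n) (simp_all add: schroeder_slicings_0)
    then show ?thesis unfolding all_schroeder_slicings_def by blast
  qed
qed

theorem theorem5:
  "root_slicing \<in> all_schroeder_slicings \<and> slicing_label root_slicing = (1, 1) \<and>
   (\<forall>(S :: slicing) (h :: nat) (k :: nat).
      S \<in> all_schroeder_slicings \<and> slicing_label S = (h, k) \<longrightarrow>
        finite (slicing_children S) \<and>
        image_mset slicing_label (mset_set (slicing_children S)) = mset (NewSch (h, k))) \<and>
   (\<forall>(n :: nat) (S :: slicing).
      S \<in> schroeder_slicings n \<longrightarrow> slicing_children S \<subseteq> schroeder_slicings (Suc n)) \<and>
   tree_iso schroeder_tree T_Sch \<and>
   (\<forall>n :: nat. n \<ge> 1 \<longrightarrow>
      finite (schroeder_slicings n) \<and>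
      real (card (schroeder_slicings n)) = large_schroeder n)"
proof (intro conjI allI impI)
  show "root_slicing \<in> all_schroeder_slicings"
    using schroeder_slicings_Suc_0 unfolding all_schroeder_slicings_def by blast
qed (use root_label label_children schroeder_children_subset schroeder_tree_iso
    card_schroeder_slicings in \<open>auto simp: all_schroeder_slicings_def\<close>)

end
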